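(* Let $1\leq r<q\leq\infty$ and let $\lambda,\mu,\nu,\alpha,\beta$ be real numbers. If $q<\infty$, then $H_{\lambda,\mu,\nu}$ is not bounded from $L^q_\alpha$ to $L^r_\beta$. If $q=\infty$, then $H_{\lambda,\mu,\nu}$ is not bounded from $L^\infty$ to $L^r_\beta$.
   Context: Let $p$ be a prime, $\mathbb{Q}_p$ the field of $p$-adic numbers with its norm $|\cdot|_p$ (so $|p|_p=p^{-1}$), $\mathbb{Q}_p^*=\mathbb{Q}_p\setminus\{0\}$, and $dx$ the Haar measure on $\mathbb{Q}_p$ normalized so that $\{x:|x|_p\leq 1\}$ has measure $1$. For $1\leq q<\infty$ and $\theta\in\mathbb{R}$, $L^q_\theta$ is the space of real-valued measurable functions $f$ on $\mathbb{Q}_p^*$ with $\|f\|_{q,\theta}=\left[\int_{\mathbb{Q}_p^*}|f(x)|^q|x|_p^\theta\,dx\right]^{1/q}<\infty$; $L^\infty$ is the space of real-valued measurable functions on $\mathbb{Q}_p^*$ with finite essential supremum norm $\|f\|_\infty$. For real $\lambda,\mu,\nu$ and a real-valued measurable $f$ on $\mathbb{Q}_p^*$, $$H_{\lambda,\mu,\nu}f(y)=\int_{\mathbb{Q}_p^*}\frac{|x|_p^\mu|y|_p^\nu}{[\max\{|x|_p,|y|_p\}]^\lambda}f(x)\,dx,\qquad y\in\mathbb{Q}_p^*.$$ "Bounded from $X$ to $Y$" means that for every $f\in X$ the integral converges absolutely for almost every $y$ and there is a constant $C$ with $\|H_{\lambda,\mu,\nu}f\|_Y\leq C\|f\|_X$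 for all $f\in X$. *)

theory Defs
  imports "HOL-Probability.Essential_Supremum" "Berlekamp_Zassenhaus.Finite_Field"
begin

section \<open>The \<open>p\<close>-adic absolute value on the rational numbers\<close>

definition padic_abs :: "nat \<Rightarrow> rat \<Rightarrow> real" where
  "padic_abs p x = (if x = 0 then 0 else
     real p powi (int (multiplicity (int p) (snd (quotient_of x)))
                - int (multiplicity (int p) (fst (quotient_of x)))))"

lemma padic_abs_0 [simp]: "padic_abs p 0 = 0"
  by (simp add: padic_abs_def)

context
  fixes p :: nat
  assumes p: "prime p"
begin

lemma padic_abs_frac:
  assumes "a \<noteq> 0" "b \<noteq> 0"
  shows "padic_abs p (of_int a / of_int b) =
    real p powi (int (multiplicity (int p) b) - int (multiplicity (int p) a))"
proof -
  have pe: "prime_elem (int p)" using p by auto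
  obtain c d where cd: "quotient_of (of_int a / of_int b) = (c, d)" by (cases "quotient_of (of_int a / of_int b)")
  have d: "d > 0" using quotient_of_denom_pos[OF cd] .
  have eq: "(of_int a / of_int b :: rat) = of_int c / of_int d" using quotient_of_div[OF cd] .
  have c: "c \<noteq> 0" using eq assms by auto
  have "(of_int (a * d) :: rat) = of_int (c * b)"
    using eq assms d by (simp add: field_simps)
  then have "a * d = c * b" by (simp only: of_int_eq_iff)
  then have "multiplicity (int p) (a * d) = multiplicity (int p) (c * b)" by simp
  then have "multiplicity (int p) a + multiplicity (int p) d = multiplicity (int p) c + multiplicity (int p) b"
    using assms c d by (simp add: prime_elem_multiplicity_mult_distrib[OF pe])
  then have "int (multiplicity (int p) d) - int (multiplicity (int p) c) = int (multiplicity (int p) b) - int (multiplicity (int p) a)"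
    by linarith
  then show ?thesis using assms cd by (simp add: padic_abs_def)
qed

lemma rat_frac_cases:
  fixes x :: rat
  obtains a b :: int where "b \<noteq> 0" "x = of_int a / of_int b"
  by (metis quotient_of_denom_pos quotient_of_div surj_pair less_irrefl)

lemma padic_abs_pos: "x \<noteq> 0 \<Longrightarrow> 0 < padic_abs p x"
  using p by (simp add: padic_abs_def prime_gt_0_nat)

lemma padic_abs_nonneg [simp]: "0 \<le> padic_abs p x"
  using padic_abs_pos[of x] by (cases "x = 0") auto

lemma padic_abs_eq_0_iff [simp]: "padic_abs p x = 0 \<longleftrightarrow> x = 0"
  using padic_abs_pos[of x] by (cases "x = 0") auto

lemma padic_abs_1 [simp]: "padic_abs p 1 = 1"
  using padic_abs_frac[of 1 1] by simp

lemma padic_abs_mult: "padic_abs p (x * y) = padic_abs p x * padic_abs p y"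
proof (cases "x = 0 \<or> y = 0")
  case False
  have pe: "prime_elem (int p)" using p by auto
  obtain a b where x: "b \<noteq> 0" "x = of_int a / of_int b" by (rule rat_frac_cases)
  obtain c d where y: "d \<noteq> 0" "y = of_int c / of_int d" by (rule rat_frac_cases)
  have ac: "a \<noteq> 0" "c \<noteq> 0" using False x y by auto
  have xy: "x * y = of_int (a * c) / of_int (b * d)" using x y by simp
  have p0: "real p \<noteq> 0" using p prime_gt_0_nat by auto
  have "b * d \<noteq> 0" "a * c \<noteq> 0" using x y ac by auto
  then have "padic_abs p (x * y) = real p powi
      (int (multiplicity (int p) (b * d)) - int (multiplicity (int p) (a * c)))"
    unfolding xy by (intro padic_abs_frac)
  also have "\<dots> = real p powi ((int (multiplicity (int p) b) - int (multiplicity (int p) a))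
      + (int (multiplicity (int p) d) - int (multiplicity (int p) c)))"
    using x(1) y(1) ac by (simp add: prime_elem_multiplicity_mult_distrib[OF pe] algebra_simps)
  also have "\<dots> = padic_abs p x * padic_abs p y"
    using p0 by (simp add: x(2) y(2) padic_abs_frac[OF ac(1) x(1)] padic_abs_frac[OF ac(2) y(1)] power_int_add)
  finally show ?thesis .
qed auto

lemma padic_abs_minus [simp]: "padic_abs p (- x) = padic_abs p x"
proof (cases "x = 0")
  case False
  obtain a b where x: "b \<noteq> 0" "x = of_int a / of_int b" by (rule rat_frac_cases)
  have "a \<noteq> 0" using False x by auto
  moreover have "- x = of_int (- a) / of_int b" using x by simp
  moreover have "multiplicity (int p) (- a) = multiplicity (int p) a"
    by (rule multiplicity_cong) simp
  ultimately show ?thesis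
    using padic_abs_frac[of "- a" b] padic_abs_frac[of a b] x by simp
qed auto

lemma padic_abs_minus_commute: "padic_abs p (x - y) = padic_abs p (y - x)"
  using padic_abs_minus[of "x - y"] by simp

lemma padic_abs_add: "padic_abs p (x + y) \<le> max (padic_abs p x) (padic_abs p y)"
proof (cases "x = 0 \<or> y = 0 \<or> x + y = 0")
  case True
  then show ?thesis by (auto simp: le_max_iff_disj)
next
  case False
  obtain a b where x: "b \<noteq> 0" "x = of_int a / of_int b" by (rule rat_frac_cases)
  obtain c d where y: "d \<noteq> 0" "y = of_int c / of_int d" by (rule rat_frac_cases)
  define m where "m = multiplicity (int p)"
  have x': "x = of_int (a * d) / of_int (b * d)" and y': "y = of_int (c * b) / of_int (b * d)"
    and xy': "x + y = of_int (a * d + c * b) / of_int (b * d)"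
    using x y by (simp_all add: field_simps)
  have nz: "b * d \<noteq> 0" "a * d \<noteq> 0" "c * b \<noteq> 0" "a * d + c * b \<noteq> 0"
  proof -
    show "b * d \<noteq> 0" using x y by simp
    show "a * d \<noteq> 0" using False x y by auto
    show "c * b \<noteq> 0" using False x y by auto
    show "a * d + c * b \<noteq> 0" using False xy' by (metis div_0 of_int_0)
  qed
  define k where "k = min (m (a * d)) (m (c * b))"
  have "int p ^ k dvd a * d" "int p ^ k dvd c * b"
    unfolding k_def m_def by (auto intro: multiplicity_dvd')
  then have "int p ^ k dvd a * d + c * b" by simp
  moreover have "\<not> is_unit (int p)" using p by auto
  ultimately have "k \<le> m (a * d + c * b)"
    unfolding m_def using nz(4) by (intro multiplicity_geI) auto
  then have "m (a * d) \<le> m (a * d + c * b) \<or> m (c * b) \<le> m (a * d + c * b)"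
    unfolding k_def by linarith
  moreover have "real p powi (int (m (b * d)) - int (m (a * d + c * b)))
       \<le> real p powi (int (m (b * d)) - int j)" if "j \<le> m (a * d + c * b)" for j
    using that p by (intro power_int_increasing) (auto dest: prime_ge_1_nat)
  ultimately show ?thesis
    unfolding le_max_iff_disj xy'
    using padic_abs_frac[OF nz(2,1)] padic_abs_frac[OF nz(3,1)] padic_abs_frac[OF nz(4,1)] x' y' m_def
    by metis
qed

lemma padic_abs_diff: "padic_abs p (x - y) \<le> max (padic_abs p x) (padic_abs p y)"
  using padic_abs_add[of x "- y"] by simp

lemma padic_abs_inverse: "padic_abs p (inverse x) = inverse (padic_abs p x)"
proof (cases "x = 0")
  case False
  then have "padic_abs p (inverse x) * padic_abs p x = 1"
    by (simp flip: padic_abs_mult)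
  then show ?thesis by (metis inverse_unique mult.commute)
qed auto

lemma padic_abs_diff_lipschitz: "\<bar>padic_abs p x - padic_abs p y\<bar> \<le> padic_abs p (x - y)"
proof -
  have "padic_abs p x \<le> max (padic_abs p (x - y)) (padic_abs p y)"
    using padic_abs_add[of "x - y" y] by simp
  moreover have "padic_abs p y \<le> max (padic_abs p (x - y)) (padic_abs p x)"
    using padic_abs_add[of "y - x" x] by (simp add: padic_abs_minus_commute)
  ultimately show ?thesis
    using padic_abs_nonneg[of x] padic_abs_nonneg[of y] padic_abs_nonneg[of "x - y"] by argo
qed

end


section \<open>The field \<open>\<rat>\<^sub>p\<close> as the completion of \<open>\<rat>\<close>\<close>

text \<open>
  The prime \<open>p\<close> is the cardinality of a type \<open>'p\<close> of class \<^class>\<open>prime_card\<close>, so that \<open>'p padic\<close>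
  is \<open>\<rat>\<^sub>p\<close> for \<open>p = CARD('p)\<close>.
\<close>

definition padic_vanishes :: "nat \<Rightarrow> (nat \<Rightarrow> rat) \<Rightarrow> bool" where
  "padic_vanishes p X \<longleftrightarrow> (\<forall>e>0. \<exists>N. \<forall>n\<ge>N. padic_abs p (X n) < e)"

definition padic_cauchy :: "nat \<Rightarrow> (nat \<Rightarrow> rat) \<Rightarrow> bool" where
  "padic_cauchy p X \<longleftrightarrow> (\<forall>e>0. \<exists>N. \<forall>m\<ge>N. \<forall>n\<ge>N. padic_abs p (X m - X n) < e)"

definition padic_rel :: "'p::prime_card itself \<Rightarrow> (nat \<Rightarrow> rat) \<Rightarrow> (nat \<Rightarrow> rat) \<Rightarrow> bool" where
  "padic_rel _ X Y \<longleftrightarrow> padic_cauchy CARD('p) X \<and> padic_cauchy CARD('p) Y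
     \<and> padic_vanishes CARD('p) (\<lambda>n. X n - Y n)"

context
  fixes p :: nat
  assumes p: "prime p"
begin

lemma padic_cauchy_const [simp]: "padic_cauchy p (\<lambda>n. c)"
  by (simp add: padic_cauchy_def)

lemma padic_vanishes_zero [simp]: "padic_vanishes p (\<lambda>n. 0)"
  by (simp add: padic_vanishes_def)

lemma padic_vanishes_const: "padic_vanishes p (\<lambda>n. c) \<longleftrightarrow> c = 0"
  using padic_abs_pos[OF p, of c] by (auto simp: padic_vanishes_def)

lemma padic_vanishes_add:
  assumes "padic_vanishes p X" "padic_vanishes p Y"
  shows "padic_vanishes p (\<lambda>n. X n + Y n)"
  unfolding padic_vanishes_def
proof (intro allI impI)
  fix e :: real assume "e > 0"
  then obtain N1 N2 where "\<forall>n\<ge>N1. padic_abs p (X n) < e" "\<forall>n\<ge>N2. padic_abs p (Y n) < e"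
    using assms unfolding padic_vanishes_def by meson
  then have "\<forall>n\<ge>max N1 N2. padic_abs p (X n + Y n) < e"
    using padic_abs_add[OF p] by (smt (verit, best) max.bounded_iff)
  then show "\<exists>N. \<forall>n\<ge>N. padic_abs p (X n + Y n) < e" by blast
qed

lemma padic_vanishes_minus: "padic_vanishes p (\<lambda>n. - X n) \<longleftrightarrow> padic_vanishes p X"
  by (simp add: padic_vanishes_def padic_abs_minus[OF p])

lemma padic_vanishes_diff:
  "padic_vanishes p X \<Longrightarrow> padic_vanishes p Y \<Longrightarrow> padic_vanishes p (\<lambda>n. X n - Y n)"
  using padic_vanishes_add[of X "\<lambda>n. - Y n"] by (simp add: padic_vanishes_minus)

lemma padic_cauchy_add:
  assumes "padic_cauchy p X" "padic_cauchy p Y"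
  shows "padic_cauchy p (\<lambda>n. X n + Y n)"
  unfolding padic_cauchy_def
proof (intro allI impI)
  fix e :: real assume "e > 0"
  then obtain N1 N2 where N: "\<forall>m\<ge>N1. \<forall>n\<ge>N1. padic_abs p (X m - X n) < e"
      "\<forall>m\<ge>N2. \<forall>n\<ge>N2. padic_abs p (Y m - Y n) < e"
    using assms unfolding padic_cauchy_def by meson
  have "padic_abs p ((X m + Y m) - (X n + Y n)) < e" if "m \<ge> max N1 N2" "n \<ge> max N1 N2" for m n
  proof -
    have "padic_abs p (X m - X n) < e" "padic_abs p (Y m - Y n) < e" using N that by auto
    moreover have "(X m + Y m) - (X n + Y n) = (X m - X n) + (Y m - Y n)" by simp
    ultimately show ?thesis using padic_abs_add[OF p, of "X m - X n" "Y m - Y n"]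
      by (metis max_less_iff_conj order_le_less_trans)
  qed
  then show "\<exists>N. \<forall>m\<ge>N. \<forall>n\<ge>N. padic_abs p ((X m + Y m) - (X n + Y n)) < e" by blast
qed

lemma padic_cauchy_minus: "padic_cauchy p X \<Longrightarrow> padic_cauchy p (\<lambda>n. - X n)"
  unfolding padic_cauchy_def
  by (metis (no_types, lifting) minus_diff_minus padic_abs_minus[OF p])

lemma padic_cauchy_diff:
  "padic_cauchy p X \<Longrightarrow> padic_cauchy p Y \<Longrightarrow> padic_cauchy p (\<lambda>n. X n - Y n)"
  using padic_cauchy_add[of X "\<lambda>n. - Y n"] padic_cauchy_minus[of Y] by simp

lemma padic_cauchy_bounded:
  assumes "padic_cauchy p X"
  obtains B where "B > 0" "\<And>n. padic_abs p (X n) < B"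
proof -
  obtain N where N: "\<forall>m\<ge>N. \<forall>n\<ge>N. padic_abs p (X m - X n) < 1"
    using assms unfolding padic_cauchy_def by (meson zero_less_one)
  define B where "B = (\<Sum>i\<le>N. padic_abs p (X i)) + 1"
  have le: "padic_abs p (X i) \<le> (\<Sum>i\<le>N. padic_abs p (X i))" if "i \<le> N" for i
    using that padic_abs_nonneg[OF p] by (intro member_le_sum) auto
  have "padic_abs p (X n) < B" for n
  proof (cases "n \<le> N")
    case True
    then show ?thesis using le[of n] by (simp add: B_def)
  next
    case False
    then have "padic_abs p (X n - X N) < 1" using N by auto
    moreover have "padic_abs p (X n) \<le> max (padic_abs p (X n - X N)) (padic_abs p (X N))"
      using padic_abs_add[OF p, of "X n - X N" "X N"] by simp
    ultimately show ?thesis using le[of N] padic_abs_nonneg[OF p, of "X N"] by (simp add: B_def)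
  qed
  moreover have "B > 0" using padic_abs_nonneg[OF p, of "X 0"] calculation[of 0] by linarith
  ultimately show ?thesis using that by blast
qed

lemma padic_vanishes_mult_bounded:
  assumes "padic_cauchy p X" "padic_vanishes p Y"
  shows "padic_vanishes p (\<lambda>n. X n * Y n)"
  unfolding padic_vanishes_def
proof (intro allI impI)
  fix e :: real assume "e > 0"
  obtain B where B: "B > 0" "\<And>n. padic_abs p (X n) < B" using padic_cauchy_bounded[OF assms(1)] by blast
  have "e / B > 0" using B \<open>e > 0\<close> by simp
  then obtain N where N: "\<forall>n\<ge>N. padic_abs p (Y n) < e / B"
    using assms(2) unfolding padic_vanishes_def by meson
  have "padic_abs p (X n * Y n) < e" if "n \<ge> N" for n
  proof -
    have "padic_abs p (X n * Y n) < B * (e / B)"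
      unfolding padic_abs_mult[OF p]
      using B N that padic_abs_nonneg[OF p] by (intro mult_strict_mono') auto
    then show ?thesis using B by simp
  qed
  then show "\<exists>N. \<forall>n\<ge>N. padic_abs p (X n * Y n) < e" by blast
qed

lemma padic_cauchy_mult:
  assumes "padic_cauchy p X" "padic_cauchy p Y"
  shows "padic_cauchy p (\<lambda>n. X n * Y n)"
  unfolding padic_cauchy_def
proof (intro allI impI)
  fix e :: real assume "e > 0"
  obtain A where A: "A > 0" "\<And>n. padic_abs p (X n) < A" using padic_cauchy_bounded[OF assms(1)] by blast
  obtain B where B: "B > 0" "\<And>n. padic_abs p (Y n) < B" using padic_cauchy_bounded[OF assms(2)] by blast
  have "e / A > 0" "e / B > 0" using A B \<open>e > 0\<close> by simp_all
  then obtain N1 N2 where N: "\<forall>m\<ge>N1. \<forall>n\<ge>N1. padic_abs p (X m - X n) < e / B"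
      "\<forall>m\<ge>N2. \<forall>n\<ge>N2. padic_abs p (Y m - Y n) < e / A"
    using assms unfolding padic_cauchy_def by meson
  have "padic_abs p (X m * Y m - X n * Y n) < e" if "m \<ge> max N1 N2" "n \<ge> max N1 N2" for m n
  proof -
    have "padic_abs p (X m * (Y m - Y n)) < A * (e / A)"
      unfolding padic_abs_mult[OF p]
      using A N that padic_abs_nonneg[OF p] by (intro mult_strict_mono') auto
    moreover have "padic_abs p ((X m - X n) * Y n) < (e / B) * B"
      unfolding padic_abs_mult[OF p]
      using B N that padic_abs_nonneg[OF p] by (intro mult_strict_mono') auto
    ultimately show ?thesis
      using padic_abs_add[OF p, of "X m * (Y m - Y n)" "(X m - X n) * Y n"] A B
      by (simp add: mult_diff_mult)
  qed
  then show "\<exists>N. \<forall>m\<ge>N. \<forall>n\<ge>N. padic_abs p (X m * Y m - X n * Y n) < e" by blast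
qed

lemma padic_cauchy_not_vanishes:
  assumes "padic_cauchy p X" "\<not> padic_vanishes p X"
  obtains b N where "b > 0" "\<And>n. n \<ge> N \<Longrightarrow> b \<le> padic_abs p (X n)"
proof -
  obtain e where e: "e > 0" "\<And>N. \<exists>n\<ge>N. padic_abs p (X n) \<ge> e"
    using assms(2) unfolding padic_vanishes_def by (meson linorder_not_less)
  obtain N where N: "\<forall>m\<ge>N. \<forall>n\<ge>N. padic_abs p (X m - X n) < e"
    using assms(1) e unfolding padic_cauchy_def by meson
  obtain k where k: "k \<ge> N" "padic_abs p (X k) \<ge> e" using e by blast
  have "e \<le> padic_abs p (X n)" if "n \<ge> N" for n
  proof -
    have "padic_abs p (X k - X n) < e" using N k that by blast
    moreover have "padic_abs p (X k) \<le> max (padic_abs p (X k - X n)) (padic_abs p (X n))"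
      using padic_abs_add[OF p, of "X k - X n" "X n"] by simp
    ultimately show ?thesis using k by linarith
  qed
  then show ?thesis using that e by blast
qed

lemma padic_abs_inverse_diff:
  assumes "b > 0" "b \<le> padic_abs p x" "b \<le> padic_abs p y"
  shows "padic_abs p (inverse x - inverse y) \<le> padic_abs p (x - y) / (b * b)"
proof -
  have nz: "x \<noteq> 0" "y \<noteq> 0" using assms by auto
  have "padic_abs p (inverse x - inverse y) = padic_abs p (x - y) / (padic_abs p x * padic_abs p y)"
    unfolding inverse_diff_inverse[OF nz] padic_abs_minus[OF p] padic_abs_mult[OF p] padic_abs_inverse[OF p]
    by (simp add: divide_simps)
  also have "\<dots> \<le> padic_abs p (x - y) / (b * b)"
    using assms padic_abs_nonneg[OF p] by (intro divide_left_mono mult_mono mult_pos_pos) auto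
  finally show ?thesis .
qed

lemma padic_cauchy_inverse:
  assumes "padic_cauchy p X" "\<not> padic_vanishes p X"
  shows "padic_cauchy p (\<lambda>n. inverse (X n))"
  unfolding padic_cauchy_def
proof (intro allI impI)
  fix e :: real assume "e > 0"
  obtain b N where b: "b > 0" "\<And>n. n \<ge> N \<Longrightarrow> b \<le> padic_abs p (X n)"
    using padic_cauchy_not_vanishes[OF assms] by metis
  have "e * (b * b) > 0" using b \<open>e > 0\<close> by simp
  then obtain M where M: "\<forall>m\<ge>M. \<forall>n\<ge>M. padic_abs p (X m - X n) < e * (b * b)"
    using assms(1) unfolding padic_cauchy_def by meson
  have "padic_abs p (inverse (X m) - inverse (X n)) < e" if "m \<ge> max M N" "n \<ge> max M N" for m n
  proof -
    have "padic_abs p (X m - X n) / (b * b) < e" using M that b by (simp add: field_simps)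
    then show ?thesis using padic_abs_inverse_diff[of b "X m" "X n"] b that by fastforce
  qed
  then show "\<exists>N. \<forall>m\<ge>N. \<forall>n\<ge>N. padic_abs p (inverse (X m) - inverse (X n)) < e" by blast
qed

lemma padic_vanishes_diff_inverse:
  assumes X: "padic_cauchy p X" "\<not> padic_vanishes p X"
    and Y: "padic_cauchy p Y" "\<not> padic_vanishes p Y"
    and XY: "padic_vanishes p (\<lambda>n. X n - Y n)"
  shows "padic_vanishes p (\<lambda>n. inverse (X n) - inverse (Y n))"
  unfolding padic_vanishes_def
proof (intro allI impI)
  fix e :: real assume "e > 0"
  obtain b1 N1 where b1: "b1 > 0" "\<And>n. n \<ge> N1 \<Longrightarrow> b1 \<le> padic_abs p (X n)"
    using padic_cauchy_not_vanishes[OF X] by metis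
  obtain b2 N2 where b2: "b2 > 0" "\<And>n. n \<ge> N2 \<Longrightarrow> b2 \<le> padic_abs p (Y n)"
    using padic_cauchy_not_vanishes[OF Y] by metis
  define b where "b = min b1 b2"
  have b: "b > 0" using b1 b2 by (simp add: b_def)
  have "e * (b * b) > 0" using b \<open>e > 0\<close> by simp
  then obtain M where M: "\<forall>n\<ge>M. padic_abs p (X n - Y n) < e * (b * b)"
    using XY unfolding padic_vanishes_def by meson
  have "padic_abs p (inverse (X n) - inverse (Y n)) < e" if "n \<ge> max M (max N1 N2)" for n
  proof -
    have "padic_abs p (X n - Y n) / (b * b) < e" using M that b by (simp add: field_simps)
    moreover have "b \<le> padic_abs p (X n)" "b \<le> padic_abs p (Y n)"
      using b1(2)[of n] b2(2)[of n] that by (auto simp: b_def)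
    ultimately show ?thesis using padic_abs_inverse_diff[of b "X n" "Y n"] b by linarith
  qed
  then show "\<exists>N. \<forall>n\<ge>N. padic_abs p (inverse (X n) - inverse (Y n)) < e" by blast
qed

lemma padic_cauchy_convergent_abs:
  assumes "padic_cauchy p X"
  shows "convergent (\<lambda>n. padic_abs p (X n))"
proof -
  have "Cauchy (\<lambda>n. padic_abs p (X n))"
    unfolding Cauchy_def dist_real_def
    using assms padic_abs_diff_lipschitz[OF p] unfolding padic_cauchy_def
    by (meson order_le_less_trans)
  then show ?thesis by (simp add: Cauchy_convergent_iff)
qed

lemma padic_vanishes_iff: "padic_vanishes p X \<longleftrightarrow> (\<lambda>n. padic_abs p (X n)) \<longlonglongrightarrow> 0"
  by (simp add: padic_vanishes_def LIMSEQ_def dist_real_def padic_abs_nonneg[OF p])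

end

lemma padic_rel_refl: "padic_cauchy CARD('p) X \<Longrightarrow> padic_rel TYPE('p::prime_card) X X"
  by (simp add: padic_rel_def padic_vanishes_def)

lemma part_equivp_padic_rel: "part_equivp (padic_rel TYPE('p::prime_card))"
proof (rule part_equivpI)
  show "\<exists>X. padic_rel TYPE('p) X X"
    using padic_rel_refl[OF padic_cauchy_const[OF prime_card]] by blast
  show "symp (padic_rel TYPE('p))"
    by (auto simp: symp_def padic_rel_def padic_vanishes_def padic_abs_minus_commute[OF prime_card])
  show "transp (padic_rel TYPE('p))"
  proof (rule transpI)
    fix X Y Z assume "padic_rel TYPE('p) X Y" "padic_rel TYPE('p) Y Z"
    then show "padic_rel TYPE('p) X Z"
      using padic_vanishes_add[OF prime_card[where 'a='p], of "\<lambda>n. X n - Y n" "\<lambda>n. Y n - Z n"]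
      by (auto simp: padic_rel_def)
  qed
qed

typedef (overloaded) 'p padic =
  "{c. \<exists>X. padic_rel TYPE('p::prime_card) X X \<and> c = Collect (padic_rel TYPE('p) X)}"
  morphisms padic_class Abs_padic
  using padic_rel_refl[OF padic_cauchy_const[OF prime_card]] by blast

definition Padic :: "(nat \<Rightarrow> rat) \<Rightarrow> 'p::prime_card padic" where
  "Padic X = Abs_padic (Collect (padic_rel TYPE('p) X))"

definition rep_padic :: "'p::prime_card padic \<Rightarrow> nat \<Rightarrow> rat" where
  "rep_padic x = (SOME X. X \<in> padic_class x)"

definition cr_padic :: "(nat \<Rightarrow> rat) \<Rightarrow> 'p::prime_card padic \<Rightarrow> bool" where
  "cr_padic = (\<lambda>X x. padic_rel TYPE('p) X X \<and> Padic X = x)"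

lemma Quotient_padic:
  "Quotient (padic_rel TYPE('p)) Padic rep_padic (cr_padic :: _ \<Rightarrow> 'p::prime_card padic \<Rightarrow> bool)"
proof -
  interpret quot_type "padic_rel TYPE('p)" "Abs_padic :: _ \<Rightarrow> 'p padic" padic_class
    by unfold_locales
      (use padic_class[where 'p='p] in
        \<open>auto simp: part_equivp_padic_rel padic_class_inverse padic_class_inject intro!: Abs_padic_inverse\<close>)
  have "abs = Padic" "rep = rep_padic"
    by (auto simp: fun_eq_iff abs_def Padic_def rep_def rep_padic_def)
  then have "Quotient3 (padic_rel TYPE('p)) Padic (rep_padic :: 'p padic \<Rightarrow> _)"
    using Quotient by simp
  then show ?thesis
    by (rule Quotient3_to_Quotient) (unfold cr_padic_def)
qed

setup_lifting Quotient_padic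

lemma cr_padic_eq: "pcr_padic = (\<lambda>X (y::'p::prime_card padic). padic_cauchy CARD('p) X \<and> Padic X = y)"
  unfolding padic.pcr_cr_eq cr_padic_def padic_rel_def
  by (auto simp: padic_vanishes_def fun_eq_iff)

lemma Domainp_pcr_padic [transfer_domain_rule]:
  "Domainp (pcr_padic :: _ \<Rightarrow> 'p::prime_card padic \<Rightarrow> bool) = padic_cauchy CARD('p)"
  by (auto simp: cr_padic_eq fun_eq_iff Domainp_iff)

lemma padic_diff_vanishes_iff:
  fixes X Y :: "nat \<Rightarrow> rat"
  assumes "padic_rel TYPE('p::prime_card) X Y"
  shows "padic_vanishes CARD('p) X \<longleftrightarrow> padic_vanishes CARD('p) Y"
proof -
  have XY: "padic_vanishes CARD('p) (\<lambda>n. X n - Y n)" using assms by (simp add: padic_rel_def)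
  show ?thesis
    using padic_vanishes_diff[OF prime_card _ XY, of X] padic_vanishes_add[OF prime_card _ XY, of Y]
    by auto
qed

instantiation padic :: (prime_card) field
begin

lift_definition zero_padic :: "'a padic" is "\<lambda>n. 0"
  by (simp add: padic_rel_refl padic_cauchy_const[OF prime_card])

lift_definition one_padic :: "'a padic" is "\<lambda>n. 1"
  by (simp add: padic_rel_refl padic_cauchy_const[OF prime_card])

lift_definition plus_padic :: "'a padic \<Rightarrow> 'a padic \<Rightarrow> 'a padic" is "\<lambda>X Y n. X n + Y n"
  unfolding padic_rel_def add_diff_add
  by (simp add: padic_cauchy_add[OF prime_card] padic_vanishes_add[OF prime_card])

lift_definition uminus_padic :: "'a padic \<Rightarrow> 'a padic" is "\<lambda>X n. - X n"
  unfolding padic_rel_def minus_diff_minus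
  by (simp only: padic_cauchy_minus[OF prime_card] padic_vanishes_minus[OF prime_card] simp_thms)

lift_definition minus_padic :: "'a padic \<Rightarrow> 'a padic \<Rightarrow> 'a padic" is "\<lambda>X Y n. X n - Y n"
proof -
  fix X X' Y Y' :: "nat \<Rightarrow> rat"
  assume "padic_rel TYPE('a) X X'" "padic_rel TYPE('a) Y Y'"
  then show "padic_rel TYPE('a) (\<lambda>n. X n - Y n) (\<lambda>n. X' n - Y' n)"
    using padic_vanishes_diff[OF prime_card[where 'a='a], of "\<lambda>n. X n - X' n" "\<lambda>n. Y n - Y' n"]
    by (simp add: padic_rel_def padic_cauchy_diff[OF prime_card] algebra_simps)
qed

lift_definition times_padic :: "'a padic \<Rightarrow> 'a padic \<Rightarrow> 'a padic" is "\<lambda>X Y n. X n * Y n"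
proof -
  fix X X' Y Y' :: "nat \<Rightarrow> rat"
  assume *: "padic_rel TYPE('a) X X'" "padic_rel TYPE('a) Y Y'"
  then have "padic_vanishes CARD('a) (\<lambda>n. X n * (Y n - Y' n) + Y' n * (X n - X' n))"
    by (intro padic_vanishes_add[OF prime_card] padic_vanishes_mult_bounded[OF prime_card])
      (auto simp: padic_rel_def)
  with * show "padic_rel TYPE('a) (\<lambda>n. X n * Y n) (\<lambda>n. X' n * Y' n)"
    by (simp add: padic_rel_def padic_cauchy_mult[OF prime_card] mult_diff_mult mult.commute)
qed

lift_definition inverse_padic :: "'a padic \<Rightarrow> 'a padic"
  is "\<lambda>X. if padic_vanishes CARD('a) X then (\<lambda>n. 0) else (\<lambda>n. inverse (X n))"
proof -
  fix X Y :: "nat \<Rightarrow> rat"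
  assume "padic_rel TYPE('a) X Y"
  then show "padic_rel TYPE('a)
      (if padic_vanishes CARD('a) X then (\<lambda>n. 0) else (\<lambda>n. inverse (X n)))
      (if padic_vanishes CARD('a) Y then (\<lambda>n. 0) else (\<lambda>n. inverse (Y n)))"
    using padic_diff_vanishes_iff[of X Y, where 'p='a]
    by (auto simp: padic_rel_def padic_cauchy_const[OF prime_card] padic_vanishes_zero
        padic_cauchy_inverse[OF prime_card] padic_vanishes_diff_inverse[OF prime_card]
        padic_vanishes_def[of _ "\<lambda>_. 0"])
qed

definition divide_padic :: "'a padic \<Rightarrow> 'a padic \<Rightarrow> 'a padic" where
  "divide_padic x y = x * inverse y"

instance
proof
  fix a b c :: "'a padic"
  note c = padic_cauchy_add[OF prime_card] padic_cauchy_mult[OF prime_card]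
    padic_cauchy_minus[OF prime_card] padic_cauchy_diff[OF prime_card] padic_cauchy_const[OF prime_card]
    padic_vanishes_zero[OF prime_card] padic_vanishes_const[OF prime_card]
  show "a + b = b + a"
    by transfer (simp add: ac_simps padic_rel_def c)
  show "(a + b) + c = a + (b + c)"
    by transfer (simp add: ac_simps padic_rel_def c)
  show "0 + a = a"
    by transfer (simp add: padic_rel_def c)
  show "- a + a = 0"
    by transfer (simp add: padic_rel_def c)
  show "a - b = a + - b"
    by transfer (simp add: padic_rel_def c)
  show "(a * b) * c = a * (b * c)"
    by transfer (simp add: ac_simps padic_rel_def c)
  show "a * b = b * a"
    by transfer (simp add: ac_simps padic_rel_def c)
  show "1 * a = a"
    by transfer (simp add: padic_rel_def c)
  show "(a + b) * c = a * c + b * c"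
    by transfer (simp add: distrib_right padic_rel_def c)
  show "(0::'a padic) \<noteq> 1"
    by transfer (simp add: padic_rel_def c)
  have inv: "padic_vanishes CARD('a) (\<lambda>n. inverse (X n) * X n - 1)"
    if X: "padic_cauchy CARD('a) X" "\<not> padic_vanishes CARD('a) X" for X
  proof -
    obtain b N where "b > 0" "\<And>n. n \<ge> N \<Longrightarrow> b \<le> padic_abs CARD('a) (X n)"
      using padic_cauchy_not_vanishes[OF prime_card X] by metis
    then have "\<forall>n\<ge>N. X n \<noteq> 0" by (metis not_less padic_abs_0)
    then have "\<forall>n\<ge>N. inverse (X n) * X n - 1 = 0" by simp
    then show ?thesis unfolding padic_vanishes_def by (metis padic_abs_0)
  qed
  show "a \<noteq> 0 \<Longrightarrow> inverse a * a = 1"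
    by transfer (simp add: padic_rel_def c inv padic_cauchy_inverse[OF prime_card])
  show "a div b = a * inverse b"
    by (rule divide_padic_def)
  show "inverse (0::'a padic) = 0"
    by transfer (simp add: padic_rel_def c)
qed

end

lift_definition padic_norm :: "'a::prime_card padic \<Rightarrow> real" is "\<lambda>X. lim (\<lambda>n. padic_abs CARD('a) (X n))"
proof -
  fix X Y :: "nat \<Rightarrow> rat"
  assume *: "padic_rel TYPE('a) X Y"
  obtain l where l: "(\<lambda>n. padic_abs CARD('a) (Y n)) \<longlonglongrightarrow> l"
    using padic_cauchy_convergent_abs[OF prime_card[where 'a='a], of Y] *
    by (auto simp: padic_rel_def convergent_def)
  have "(\<lambda>n. padic_abs CARD('a) (X n) - padic_abs CARD('a) (Y n)) \<longlonglongrightarrow> 0"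
  proof (rule Lim_null_comparison)
    show "\<forall>\<^sub>F n in sequentially. norm (padic_abs CARD('a) (X n) - padic_abs CARD('a) (Y n))
        \<le> padic_abs CARD('a) (X n - Y n)"
      using padic_abs_diff_lipschitz[OF prime_card[where 'a='a]] by auto
    show "(\<lambda>n. padic_abs CARD('a) (X n - Y n)) \<longlonglongrightarrow> 0"
      using * by (simp add: padic_rel_def padic_vanishes_iff[OF prime_card])
  qed
  from tendsto_add[OF this l] have "(\<lambda>n. padic_abs CARD('a) (X n)) \<longlonglongrightarrow> l" by simp
  with l show "lim (\<lambda>n. padic_abs CARD('a) (X n)) = lim (\<lambda>n. padic_abs CARD('a) (Y n))"
    by (simp add: limI)
qed

lemma padic_tendsto_norm:
  assumes "padic_cauchy CARD('p) X"
  shows "(\<lambda>n. padic_abs CARD('p) (X n)) \<longlonglongrightarrow> padic_norm (Padic X :: 'p::prime_card padic)"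
proof -
  have "padic_norm (Padic X :: 'p padic) = lim (\<lambda>n. padic_abs CARD('p) (X n))"
    using padic_norm.transfer[where 'a='p] assms by (auto simp: cr_padic_eq rel_fun_def)
  then show ?thesis
    using padic_cauchy_convergent_abs[OF prime_card assms] by (simp add: convergent_LIMSEQ_iff)
qed

lemma padic_induct [case_names Padic, induct type: padic]:
  assumes "\<And>X. padic_cauchy CARD('p) X \<Longrightarrow> P (Padic X)"
  shows "P (x :: 'p::prime_card padic)"
proof -
  have "padic_cauchy CARD('p) (rep_padic x)" "Padic (rep_padic x) = x"
    using Quotient_rep_reflp[OF Quotient_padic, of x] Quotient_abs_rep[OF Quotient_padic, of x]
    by (simp_all add: padic_rel_def)
  then show ?thesis using assms by metis
qed

lemma Padic_eq_iff:
  assumes "padic_cauchy CARD('p) X" "padic_cauchy CARD('p) Y"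
  shows "(Padic X :: 'p::prime_card padic) = Padic Y \<longleftrightarrow> padic_vanishes CARD('p) (\<lambda>n. X n - Y n)"
  using padic.rel_eq_transfer[where 'p='p] assms
  by (auto simp: cr_padic_eq rel_fun_def padic_rel_def)

lemma Padic_add:
  assumes "padic_cauchy CARD('p) X" "padic_cauchy CARD('p) Y"
  shows "(Padic X :: 'p::prime_card padic) + Padic Y = Padic (\<lambda>n. X n + Y n)"
  using plus_padic.transfer[where 'a='p] assms by (simp add: cr_padic_eq rel_fun_def)

lemma Padic_diff:
  assumes "padic_cauchy CARD('p) X" "padic_cauchy CARD('p) Y"
  shows "(Padic X :: 'p::prime_card padic) - Padic Y = Padic (\<lambda>n. X n - Y n)"
  using minus_padic.transfer[where 'a='p] assms by (simp add: cr_padic_eq rel_fun_def)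

lemma Padic_mult:
  assumes "padic_cauchy CARD('p) X" "padic_cauchy CARD('p) Y"
  shows "(Padic X :: 'p::prime_card padic) * Padic Y = Padic (\<lambda>n. X n * Y n)"
  using times_padic.transfer[where 'a='p] assms by (simp add: cr_padic_eq rel_fun_def)

lemma Padic_zero: "(0 :: 'p::prime_card padic) = Padic (\<lambda>n. 0)"
  using zero_padic.transfer[where 'a='p] by (simp add: cr_padic_eq)

lemma Padic_one: "(1 :: 'p::prime_card padic) = Padic (\<lambda>n. 1)"
  using one_padic.transfer[where 'a='p] by (simp add: cr_padic_eq)

lemma padic_norm_nonneg [simp]: "0 \<le> padic_norm (x :: 'p::prime_card padic)"
proof (induct x)
  case (Padic X)
  show ?case
    using padic_tendsto_norm[OF Padic] padic_abs_nonneg[OF prime_card[where 'a='p]]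
    by (intro LIMSEQ_le_const) auto
qed

lemma padic_norm_eq_0_iff [simp]: "padic_norm (x :: 'p::prime_card padic) = 0 \<longleftrightarrow> x = 0"
proof (induct x)
  case (Padic X)
  have "padic_norm (Padic X :: 'p padic) = 0 \<longleftrightarrow> padic_vanishes CARD('p) X"
    using padic_tendsto_norm[OF Padic] padic_vanishes_iff[OF prime_card[where 'a='p], of X]
    by (metis LIMSEQ_unique)
  also have "\<dots> \<longleftrightarrow> (Padic X :: 'p padic) = 0"
    using Padic_eq_iff[OF Padic padic_cauchy_const[OF prime_card], of 0] by (simp add: Padic_zero)
  finally show ?case .
qed

lemma padic_norm_mult: "padic_norm (x * y :: 'p::prime_card padic) = padic_norm x * padic_norm y"
proof (induct x)
  case X: (Padic X)
  show ?case
  proof (induct y)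
    case Y: (Padic Y)
    show ?case
      using padic_tendsto_norm[OF padic_cauchy_mult[OF prime_card X Y]]
        tendsto_mult[OF padic_tendsto_norm[OF X] padic_tendsto_norm[OF Y]]
      by (simp add: Padic_mult[OF X Y] padic_abs_mult[OF prime_card] LIMSEQ_unique)
  qed
qed

lemma padic_norm_add: "padic_norm (x + y :: 'p::prime_card padic) \<le> max (padic_norm x) (padic_norm y)"
proof (induct x)
  case X: (Padic X)
  show ?case
  proof (induct y)
    case Y: (Padic Y)
    show ?case
      unfolding Padic_add[OF X Y]
      by (rule LIMSEQ_le[OF padic_tendsto_norm[OF padic_cauchy_add[OF prime_card X Y]]
            tendsto_max[OF padic_tendsto_norm[OF X] padic_tendsto_norm[OF Y]]])
        (auto intro: padic_abs_add[OF prime_card])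
  qed
qed

lemma padic_norm_one [simp]: "padic_norm (1 :: 'p::prime_card padic) = 1"
  using padic_norm_mult[of "1 :: 'p padic" 1] by simp

lemma padic_norm_minus [simp]: "padic_norm (- x :: 'p::prime_card padic) = padic_norm x"
proof -
  have "padic_norm (- 1 :: 'p padic) * padic_norm (- 1 :: 'p padic) = 1"
    by (simp flip: padic_norm_mult)
  then have "padic_norm (- 1 :: 'p padic) = 1"
    by (metis abs_of_nonneg abs_square_eq_1 padic_norm_nonneg power2_eq_square)
  then show ?thesis using padic_norm_mult[of "- 1" x] by simp
qed

lemma padic_norm_minus_commute: "padic_norm (x - y :: 'p::prime_card padic) = padic_norm (y - x)"
  using padic_norm_minus[of "x - y"] by simp

instantiation padic :: (prime_card) metric_space
begin

definition dist_padic :: "'a padic \<Rightarrow> 'a padic \<Rightarrow> real" where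
  "dist_padic x y = padic_norm (x - y)"

definition uniformity_padic :: "('a padic \<times> 'a padic) filter" where
  "uniformity_padic = (INF e\<in>{0<..}. principal {(x, y). dist x y < e})"

definition open_padic :: "'a padic set \<Rightarrow> bool" where
  "open_padic U \<longleftrightarrow> (\<forall>x\<in>U. eventually (\<lambda>(x', y). x' = x \<longrightarrow> y \<in> U) uniformity)"

instance
proof
  fix x y z :: "'a padic"
  show "dist x y = 0 \<longleftrightarrow> x = y" by (simp add: dist_padic_def)
  have "padic_norm (x - y) \<le> max (padic_norm (x - z)) (padic_norm (z - y))"
    using padic_norm_add[of "x - z" "z - y"] by simp
  also have "\<dots> \<le> padic_norm (x - z) + padic_norm (z - y)"
    using padic_norm_nonneg[of "x - z"] padic_norm_nonneg[of "z - y"] by linarith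
  finally show "dist x y \<le> dist x z + dist y z"
    by (simp add: dist_padic_def padic_norm_minus_commute[of y z])
qed (simp_all add: uniformity_padic_def open_padic_def)

end

lemma of_nat_padic: "(of_nat k :: 'p::prime_card padic) = Padic (\<lambda>n. of_nat k)"
  by (induct k) (simp_all add: Padic_zero Padic_one Padic_add padic_cauchy_const[OF prime_card])

lemma norm_Padic_const: "padic_norm (Padic (\<lambda>n. c) :: 'p::prime_card padic) = padic_abs CARD('p) c"
  using padic_tendsto_norm[OF padic_cauchy_const[OF prime_card[where 'a='p]], of c]
  by (simp add: LIMSEQ_const_iff)

instance padic :: (prime_card) field_char_0
proof
  show "inj (of_nat :: nat \<Rightarrow> 'a padic)"
    by (rule injI)
      (auto simp: of_nat_padic Padic_eq_iff padic_cauchy_const[OF prime_card] padic_vanishes_const[OF prime_card])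
qed

lemma of_int_padic: "(of_int k :: 'p::prime_card padic) = Padic (\<lambda>n. of_int k)"
proof (cases k)
  case (nonneg n)
  then show ?thesis by (simp add: of_nat_padic)
next
  case (neg n)
  have "(of_int k :: 'p padic) = 0 - of_nat (Suc n)" using neg by simp
  also have "\<dots> = Padic (\<lambda>_. of_int k)"
    unfolding of_nat_padic Padic_zero using neg by (simp add: Padic_diff padic_cauchy_const[OF prime_card])
  finally show ?thesis .
qed

lemma of_rat_padic: "(of_rat c :: 'p::prime_card padic) = Padic (\<lambda>n. c)"
proof -
  obtain a b where c: "b \<noteq> 0" "c = of_int a / of_int b"
    by (metis quotient_of_denom_pos quotient_of_div surj_pair less_irrefl)
  have "Padic (\<lambda>n. c) * (of_int b :: 'p padic) = of_int a"
    using c by (simp add: of_int_padic Padic_mult padic_cauchy_const[OF prime_card])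
  then have "Padic (\<lambda>n. c) = (of_int a / of_int b :: 'p padic)"
    using c(1) by (simp add: eq_divide_eq)
  then show ?thesis by (simp add: c(2) of_rat_divide)
qed

lemma norm_of_rat_padic [simp]: "padic_norm (of_rat c :: 'p::prime_card padic) = padic_abs CARD('p) c"
  by (simp add: of_rat_padic norm_Padic_const)

lemma norm_prime_padic: "padic_norm (of_nat CARD('p) :: 'p::prime_card padic) = 1 / CARD('p)"
proof -
  have p: "prime (int CARD('p))" using prime_card[where 'a='p] by simp
  then have "multiplicity (int CARD('p)) (int CARD('p)) = 1"
    by (intro multiplicity_self) auto
  moreover have "CARD('p) \<noteq> 0" using p by (metis not_prime_0 of_nat_0)
  ultimately have "padic_abs CARD('p) (of_nat CARD('p)) = 1 / CARD('p)"
    using padic_abs_frac[OF prime_card[where 'a='p], of "int CARD('p)" 1] by (simp add: power_int_minus_divide)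
  then show ?thesis by (simp add: of_nat_padic norm_Padic_const)
qed

lemma padic_of_rat_tendsto:
  assumes "padic_cauchy CARD('p) X"
  shows "(\<lambda>n. of_rat (X n)) \<longlonglongrightarrow> (Padic X :: 'p::prime_card padic)"
proof (rule metric_LIMSEQ_I)
  fix e :: real assume "e > 0"
  then have "e / 2 > 0" by simp
  then obtain N where N: "\<forall>m\<ge>N. \<forall>n\<ge>N. padic_abs CARD('p) (X m - X n) < e / 2"
    using assms unfolding padic_cauchy_def by meson
  have "dist (of_rat (X n)) (Padic X :: 'p padic) < e" if "n \<ge> N" for n
  proof -
    have c: "padic_cauchy CARD('p) (\<lambda>m. X n - X m)"
      by (intro padic_cauchy_diff[OF prime_card] padic_cauchy_const[OF prime_card] assms)
    have "padic_norm (Padic (\<lambda>m. X n - X m) :: 'p padic) \<le> e / 2"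
      by (rule LIMSEQ_le_const2[OF padic_tendsto_norm[OF c]]) (use N that less_imp_le in blast)
    then show ?thesis
      using \<open>e > 0\<close>
      by (simp add: dist_padic_def of_rat_padic Padic_diff[OF padic_cauchy_const[OF prime_card] assms])
  qed
  then show "\<exists>N. \<forall>n\<ge>N. dist (of_rat (X n)) (Padic X :: 'p padic) < e" by blast
qed

lemma padic_rat_dense:
  fixes x :: "'p::prime_card padic"
  assumes "e > 0"
  shows "\<exists>c. dist x (of_rat c) < e"
proof (induct x)
  case (Padic X)
  show ?case
    using metric_LIMSEQ_D[OF padic_of_rat_tendsto[OF Padic] assms] by (metis dist_commute order_refl)
qed

instance padic :: (prime_card) complete_space
proof
  fix X :: "nat \<Rightarrow> 'a padic"
  assume X: "Cauchy X"
  have "\<forall>n. \<exists>c. dist (X n) (of_rat c) < inverse (real (Suc n))"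
    by (intro allI padic_rat_dense) simp
  then obtain q where q: "\<And>n. dist (X n) (of_rat (q n)) < inverse (real (Suc n))"
    by metis
  have lim0: "(\<lambda>n. dist (X n) (of_rat (q n))) \<longlonglongrightarrow> 0"
  proof (rule Lim_null_comparison[OF _ LIMSEQ_inverse_real_of_nat])
    show "\<forall>\<^sub>F n in sequentially. norm (dist (X n) (of_rat (q n))) \<le> inverse (real (Suc n))"
      using less_imp_le[OF q] by (intro always_eventually allI) (simp only: real_norm_def abs_of_nonneg zero_le_dist)
  qed
  have "padic_cauchy CARD('a) q"
    unfolding padic_cauchy_def
  proof (intro allI impI)
    fix e :: real assume e: "e > 0"
    then have e3: "e / 3 > 0" by simp
    obtain N where N: "\<forall>m\<ge>N. \<forall>n\<ge>N. dist (X m) (X n) < e / 3"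
      using X e3 unfolding Cauchy_def by meson
    obtain M where M: "\<forall>n\<ge>M. dist (X n) (of_rat (q n)) < e / 3"
      using metric_LIMSEQ_D[OF lim0 e3] by auto
    have "padic_abs CARD('a) (q m - q n) < e" if "m \<ge> max M N" "n \<ge> max M N" for m n
    proof -
      have "padic_abs CARD('a) (q m - q n) = dist (of_rat (q m) :: 'a padic) (of_rat (q n))"
        by (simp add: dist_padic_def flip: of_rat_diff)
      also have "\<dots> \<le> dist (X m) (of_rat (q m)) + dist (X m) (X n) + dist (X n) (of_rat (q n))"
        by metric
      also have "\<dots> < e"
      proof -
        have "dist (X m) (X n) < e / 3" using N that by auto
        moreover have "dist (X m) (of_rat (q m)) < e / 3" "dist (X n) (of_rat (q n)) < e / 3"
          using M that by auto
        ultimately show ?thesis by linarith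
      qed
      finally show ?thesis .
    qed
    then show "\<exists>N. \<forall>m\<ge>N. \<forall>n\<ge>N. padic_abs CARD('a) (q m - q n) < e" by blast
  qed
  then have "(\<lambda>n. dist (of_rat (q n)) (Padic q :: 'a padic)) \<longlonglongrightarrow> 0"
    by (intro tendsto_dist_iff[THEN iffD1] padic_of_rat_tendsto)
  from tendsto_add[OF lim0 this]
  have lim: "(\<lambda>n. dist (X n) (of_rat (q n)) + dist (of_rat (q n) :: 'a padic) (Padic q)) \<longlonglongrightarrow> 0" by simp
  have "(\<lambda>n. dist (X n) (Padic q)) \<longlonglongrightarrow> 0"
    by (rule tendsto_sandwich[OF _ _ tendsto_const lim]) (simp_all add: dist_triangle)
  then have "X \<longlonglongrightarrow> Padic q" by (rule tendsto_dist_iff[THEN iffD2])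
  then show "convergent X" by (auto simp: convergent_def)
qed


section \<open>Haar measure, weighted Lebesgue spaces and the operator\<close>

definition is_padic_haar :: "'p::prime_card padic measure \<Rightarrow> bool" where
  "is_padic_haar M \<longleftrightarrow> sets M = sets borel
     \<and> (\<forall>a. \<forall>A\<in>sets borel. emeasure M ((+) a ` A) = emeasure M A)
     \<and> emeasure M {x. padic_norm x \<le> 1} = 1"

definition units_measure :: "'p::prime_card padic measure \<Rightarrow> 'p padic measure" where
  "units_measure M = restrict_space M (- {0})"

definition Lq :: "'p::prime_card padic measure \<Rightarrow> real \<Rightarrow> real \<Rightarrow> ('p padic \<Rightarrow> real) set" where
  "Lq M q \<theta> = {f \<in> borel_measurable (units_measure M).
     integrable (units_measure M) (\<lambda>x. \<bar>f x\<bar> powr q * padic_norm x powr \<theta>)}"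

definition Lq_norm :: "'p::prime_card padic measure \<Rightarrow> real \<Rightarrow> real \<Rightarrow> ('p padic \<Rightarrow> real) \<Rightarrow> real" where
  "Lq_norm M q \<theta> f = (LINT x|units_measure M. \<bar>f x\<bar> powr q * padic_norm x powr \<theta>) powr (1 / q)"

definition Linf :: "'p::prime_card padic measure \<Rightarrow> ('p padic \<Rightarrow> real) set" where
  "Linf M = {f \<in> borel_measurable (units_measure M).
     esssup (units_measure M) (\<lambda>x. ereal \<bar>f x\<bar>) < \<infinity>}"

definition Linf_norm :: "'p::prime_card padic measure \<Rightarrow> ('p padic \<Rightarrow> real) \<Rightarrow> real" where
  "Linf_norm M f = real_of_ereal (esssup (units_measure M) (\<lambda>x. ereal \<bar>f x\<bar>))"

definition H_integrand ::
  "real \<Rightarrow> real \<Rightarrow> real \<Rightarrow> ('p::prime_card padic \<Rightarrow> real) \<Rightarrow> 'p padic \<Rightarrow> 'p padic \<Rightarrow> real" where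
  "H_integrand lam \<mu> \<nu> f y x =
     padic_norm x powr \<mu> * padic_norm y powr \<nu> / (max (padic_norm x) (padic_norm y)) powr lam * f x"

definition H_op :: "'p::prime_card padic measure \<Rightarrow>
    real \<Rightarrow> real \<Rightarrow> real \<Rightarrow> ('p padic \<Rightarrow> real) \<Rightarrow> 'p padic \<Rightarrow> real" where
  "H_op M lam \<mu> \<nu> f y = (LINT x|units_measure M. H_integrand lam \<mu> \<nu> f y x)"

text \<open>
  \<open>X\<close> and \<open>Y\<close> are function spaces with norms \<open>nX\<close> and \<open>nY\<close>. Since \<open>nY\<close> is real-valued, finiteness
  of the \<open>Y\<close>-norm of the image is the condition that the image lies in \<open>Y\<close>.
\<close>

definition H_bounded :: "'p::prime_card padic measure \<Rightarrow> real \<Rightarrow> real \<Rightarrow> real \<Rightarrow>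
    ('p padic \<Rightarrow> real) set \<Rightarrow> (('p padic \<Rightarrow> real) \<Rightarrow> real) \<Rightarrow>
    ('p padic \<Rightarrow> real) set \<Rightarrow> (('p padic \<Rightarrow> real) \<Rightarrow> real) \<Rightarrow> bool" where
  "H_bounded M lam \<mu> \<nu> X nX Y nY \<longleftrightarrow>
     (\<forall>f\<in>X. AE y in units_measure M. integrable (units_measure M) (H_integrand lam \<mu> \<nu> f y))
     \<and> (\<exists>C. \<forall>f\<in>X. H_op M lam \<mu> \<nu> f \<in> Y \<and> nY (H_op M lam \<mu> \<nu> f) \<le> C * nX f)"

end

theory Submission
  imports Defs
begin

text \<open>
  Test the operator on \<open>f = (\<Sum>k\<in>F. p\<^bsup>-ak\<^esup> \<one>\<^bsub>S k\<^esub>)\<close>, where \<open>S k\<close> is the sphere of radius \<open>p\<^bsup>k\<^esup>\<close>, \<open>F\<close>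
  consists of \<open>N\<close> consecutive integers, and \<open>a = (\<alpha> + 1) / q\<close> makes each sphere contribute equally
  to the norm of \<open>f\<close>, which is therefore of order \<open>N\<^bsup>1/q\<^esup>\<close> (with \<open>a = 0\<close>, \<open>1/q = 0\<close> for \<open>q = \<infinity>\<close>).
  The kernel is positive, so on \<open>S j\<close> the image is at least the contribution of \<open>S j\<close> itself, and
  the \<open>r\<close>-th power of the norm of the image is at least a constant times \<open>\<Sum>j\<in>F. p\<^bsup>jD\<^esup>\<close> for some
  exponent \<open>D\<close>. Placing \<open>F\<close> on the side of \<open>0\<close> where \<open>jD \<ge> 0\<close> makes this sum at least \<open>N\<close>, and
  boundedness would give \<open>N\<^bsup>1/r\<^esup> \<le> C N\<^bsup>1/q\<^esup>\<close> for all \<open>N\<close>, contradicting \<open>r < q\<close>.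
\<close>

section \<open>The residue field and the value group\<close>

lemma prime_card_gt_1: "1 < real CARD('p::prime_card)"
  using prime_gt_1_nat[OF prime_card[where 'a='p]] by simp

lemma padic_norm_zero [simp]: "padic_norm (0 :: 'p::prime_card padic) = 0"
  by simp

lemma padic_norm_diff_le:
  "padic_norm (x - y :: 'p::prime_card padic) \<le> max (padic_norm x) (padic_norm y)"
  using padic_norm_add[of x "- y"] by simp

lemma padic_norm_power: "padic_norm (x ^ n :: 'p::prime_card padic) = padic_norm x ^ n"
  by (induct n) (simp_all add: padic_norm_mult)

lemma padic_norm_inverse: "padic_norm (inverse x :: 'p::prime_card padic) = inverse (padic_norm x)"
proof (cases "x = 0")
  case False
  then have "padic_norm (inverse x) * padic_norm x = 1"
    by (simp flip: padic_norm_mult)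
  then show ?thesis by (metis inverse_unique mult.commute)
qed auto

lemma padic_norm_of_int:
  assumes "n \<noteq> 0"
  shows "padic_norm (of_int n :: 'p::prime_card padic)
    = real CARD('p) powi (- int (multiplicity (int CARD('p)) n))"
proof -
  have "padic_norm (of_int n :: 'p padic) = padic_abs CARD('p) (of_int n / of_int 1)"
    by (simp add: of_int_padic norm_Padic_const)
  also have "\<dots> = real CARD('p) powi (- int (multiplicity (int CARD('p)) n))"
    using padic_abs_frac[OF prime_card[where 'a='p] assms, of 1] by simp
  finally show ?thesis .
qed

lemma padic_norm_of_int_le_1: "padic_norm (of_int n :: 'p::prime_card padic) \<le> 1"
proof (cases "n = 0")
  case False
  have "real CARD('p) powi (- int (multiplicity (int CARD('p)) n)) \<le> real CARD('p) powi 0"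
    using prime_card_gt_1[where 'p='p] by (intro power_int_increasing) auto
  then show ?thesis by (simp add: padic_norm_of_int[OF False])
qed auto

lemma padic_norm_of_int_less_1_iff:
  "padic_norm (of_int n :: 'p::prime_card padic) < 1 \<longleftrightarrow> int CARD('p) dvd n"
proof (cases "n = 0")
  case False
  have P: "\<not> is_unit (int CARD('p))" using prime_card_gt_1[where 'p='p] by simp
  have "real CARD('p) powi (- int m) < 1 \<longleftrightarrow> m > 0" for m
    using prime_card_gt_1[where 'p='p]
    by (cases "m = 0") (auto simp: power_int_minus intro: inverse_less_1_iff[THEN iffD2])
  then show ?thesis
    using False P by (simp add: padic_norm_of_int multiplicity_gt_zero_iff)
qed auto

text \<open>Near a nonzero \<open>x\<close> the norm is constant, so its values are those attained on \<open>\<rat>\<close>.\<close>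
lemma padic_norm_eq_powr:
  fixes x :: "'p::prime_card padic"
  assumes "x \<noteq> 0"
  obtains k :: int where "padic_norm x = real CARD('p) powr k"
proof -
  have "padic_norm x > 0"
    using assms padic_norm_nonneg[of x] padic_norm_eq_0_iff[of x] by linarith
  then obtain c where c: "padic_norm (x - of_rat c) < padic_norm x"
    using padic_rat_dense[of "padic_norm x" x] by (auto simp: dist_padic_def)
  have "padic_norm x \<le> max (padic_norm (x - of_rat c)) (padic_norm (of_rat c :: 'p padic))"
    using padic_norm_add[of "x - of_rat c" "of_rat c"] by simp
  moreover have "padic_norm (of_rat c :: 'p padic) \<le> max (padic_norm x) (padic_norm (x - of_rat c))"
    using padic_norm_diff_le[of x "x - of_rat c"] by simp
  ultimately have eq: "padic_norm x = padic_abs CARD('p) c"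
    using c by (auto simp: max_def split: if_splits)
  then have "c \<noteq> 0" using \<open>padic_norm x > 0\<close> by auto
  with eq obtain k :: int where "padic_norm x = real CARD('p) powi k"
    by (auto simp: padic_abs_def)
  then show thesis
    using that[of k] prime_card_gt_1[where 'p='p] by (simp add: powr_real_of_int')
qed

text \<open>The integers below \<open>p\<close> represent the whole residue field. A rational within
  distance less than 1 of \<open>x\<close> has, in lowest terms, a denominator prime to
  \<open>p\<close>; that denominator is invertible modulo \<open>p\<close>, which reduces the
  fraction to an integer.\<close>

lemma padic_residue_ex:
  fixes x :: "'p::prime_card padic"
  assumes "padic_norm x \<le> 1"
  obtains i :: nat where "i < CARD('p)" "padic_norm (x - of_nat i) < 1"
proof -
  let ?p = "int CARD('p)"
  have pr: "prime ?p" using prime_card[where 'a='p] by simp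
  obtain c where c: "padic_norm (x - of_rat c) < 1"
    using padic_rat_dense[of 1 x] by (auto simp: dist_padic_def)
  obtain a b where ab: "quotient_of c = (a, b)" by (cases "quotient_of c")
  have b: "b > 0" "coprime a b" and ceq: "c = of_int a / of_int b"
    using quotient_of_denom_pos[OF ab] quotient_of_coprime[OF ab] quotient_of_div[OF ab] by auto
  have c1: "padic_norm (of_rat c :: 'p padic) \<le> 1"
    using padic_norm_diff_le[of x "x - of_rat c"] c assms by simp
  have cb: "of_rat c * of_int b = (of_int a :: 'p padic)"
    using b by (simp add: ceq of_rat_divide)
  \<comment> \<open>If \<open>p\<close> divided \<open>b\<close>, then
    \<open>|a| = |c| |b| < 1\<close> would force \<open>p\<close> to divide \<open>a\<close> too,
    against lowest terms.\<close>
  have nb: "\<not> ?p dvd b"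
  proof
    assume "?p dvd b"
    then have "padic_norm (of_int b :: 'p padic) < 1"
      by (simp add: padic_norm_of_int_less_1_iff)
    moreover have "padic_norm (of_int a :: 'p padic)
        = padic_norm (of_rat c :: 'p padic) * padic_norm (of_int b :: 'p padic)"
      unfolding cb[symmetric] by (rule padic_norm_mult)
    ultimately have "padic_norm (of_int a :: 'p padic) < 1"
      using c1 mult_right_mono[OF c1, of "padic_norm (of_int b :: 'p padic)"]
        padic_norm_nonneg[of "of_int b :: 'p padic"] by simp
    then have "?p dvd a" by (simp add: padic_norm_of_int_less_1_iff)
    with \<open>?p dvd b\<close> b(2) pr show False
      by (meson coprime_common_divisor not_prime_unit)
  qed
  then have "coprime b ?p"
    using prime_imp_coprime[OF pr] coprime_commute by blast
  then obtain b' where b': "[b * b' = 1] (mod ?p)"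
    using cong_solve_coprime_int by blast
  \<comment> \<open>The representative \<open>i\<close> solves \<open>i * b = a\<close> modulo
    \<open>p\<close>; as \<open>|b| = 1\<close>, this yields \<open>|c - i| < 1\<close>.\<close>
  define i where "i = nat ((a * b') mod ?p)"
  have i: "i < CARD('p)" "int i = (a * b') mod ?p"
    using pr prime_gt_0_int by (auto simp: i_def nat_less_iff)
  have "[int i * b = a * b' * b] (mod ?p)"
    unfolding i by (simp add: cong_def mod_mult_left_eq)
  then have "[a - int i * b = a - a * (b * b')] (mod ?p)"
    by (intro cong_diff) (simp_all add: ac_simps)
  also have "[a - a * (b * b') = a - a * 1] (mod ?p)"
    by (intro cong_diff cong_mult b') auto
  finally have "?p dvd a - int i * b" by (simp add: cong_0_iff)
  then have "padic_norm (of_int (a - int i * b) :: 'p padic) < 1"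
    by (simp only: padic_norm_of_int_less_1_iff)
  also have "of_int (a - int i * b) = (of_rat c - of_nat i) * (of_int b :: 'p padic)"
    by (simp add: algebra_simps flip: cb)
  finally have "padic_norm (of_rat c - of_nat i :: 'p padic) * padic_norm (of_int b :: 'p padic) < 1"
    by (simp add: padic_norm_mult)
  moreover have "padic_norm (of_int b :: 'p padic) = 1"
    using nb padic_norm_of_int_less_1_iff[of b, where 'p='p] padic_norm_of_int_le_1[of b, where 'p='p] by linarith
  ultimately have "padic_norm (of_rat c - of_nat i :: 'p padic) < 1" by simp
  with c have "padic_norm (x - of_nat i) < 1"
    using padic_norm_add[of "x - of_rat c" "of_rat c - of_nat i"] by simp
  with i(1) that show thesis by blast
qed

section \<open>Haar measure of balls and spheres\<close>

definition padic_ball :: "int \<Rightarrow> 'p::prime_card padic set" where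
  "padic_ball k = {x. padic_norm x \<le> real CARD('p) powr k}"

definition padic_sphere :: "int \<Rightarrow> 'p::prime_card padic set" where
  "padic_sphere k = {x. padic_norm x = real CARD('p) powr k}"

text \<open>The value group is discrete: no norm lies strictly between two consecutive powers of
  \<open>p\<close>. Strict bounds thereby turn into membership in the next smaller ball.\<close>

lemma padic_ball_conv_less:
  "(padic_ball k :: 'p::prime_card padic set) = {x. padic_norm x < real CARD('p) powr (k + 1)}"
proof -
  have "padic_norm x \<le> real CARD('p) powr k \<longleftrightarrow> padic_norm x < real CARD('p) powr (k + 1)"
    for x :: "'p padic"
  proof (cases "x = 0")
    case False
    then obtain m :: int where "padic_norm x = real CARD('p) powr m" by (rule padic_norm_eq_powr)
    then show ?thesis using prime_card_gt_1[where 'p='p] by simp linarith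
  qed (use prime_card_gt_1[where 'p='p] in simp)
  then show ?thesis by (auto simp: padic_ball_def)
qed

lemma padic_sphere_eq_diff:
  "(padic_sphere k :: 'p::prime_card padic set) = padic_ball k - padic_ball (k - 1)"
  unfolding padic_sphere_def padic_ball_conv_less[of "k - 1"] by (auto simp: padic_ball_def)

lemma borel_measurable_padic_norm [measurable]:
  "(padic_norm :: 'p::prime_card padic \<Rightarrow> real) \<in> borel_measurable borel"
proof -
  have "padic_norm = (\<lambda>x :: 'p padic. dist x 0)" by (simp add: dist_padic_def fun_eq_iff)
  moreover have "continuous_on UNIV (\<lambda>x :: 'p padic. dist x 0)" by (intro continuous_intros)
  ultimately show ?thesis by (metis borel_measurable_continuous_onI)
qed

lemma padic_ball_borel [measurable]: "padic_ball k \<in> sets borel"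
  unfolding padic_ball_def by measurable

lemma padic_sphere_borel [measurable]: "padic_sphere k \<in> sets borel"
  unfolding padic_sphere_def by measurable

lemma padic_norm_powr_ex:
  fixes k :: int
  obtains t :: "'p::prime_card padic" where "padic_norm t = real CARD('p) powr k"
proof -
  have "padic_norm (of_nat CARD('p) ^ n :: 'p padic) = real CARD('p) powr (- real n)" for n
    using prime_card_gt_1[where 'p='p]
    by (simp add: padic_norm_power norm_prime_padic powr_minus powr_realpow power_one_over inverse_eq_divide)
  \<comment> \<open>Since \<open>nat\<close> sends negative integers to 0, the first witness serves
    \<open>k \<le> 0\<close> and the second \<open>k \<ge> 0\<close>.\<close>
  then have "padic_norm (of_nat CARD('p) ^ nat (- k) :: 'p padic) = real CARD('p) powr k \<or>
      padic_norm (inverse (of_nat CARD('p) ^ nat k) :: 'p padic) = real CARD('p) powr k"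
    by (cases "k \<ge> 0") (simp_all add: padic_norm_inverse powr_minus)
  then show thesis using that by blast
qed

section \<open>Splitting a ball into \<open>p\<close> translates of the next smaller ball\<close>

text \<open>Division by \<open>t\<close> carries the larger ball to the unit ball, where each point
  is congruent to some \<open>i < p\<close>; scaling back turns the residue classes into the
  translates.\<close>

lemma padic_ball_Suc_eq:
  fixes t :: "'p::prime_card padic"
  assumes t: "padic_norm t = real CARD('p) powr (of_int (k + 1))"
  shows "padic_ball (k + 1) = (\<Union>i<CARD('p). (+) (of_nat i * t) ` padic_ball k)"
proof (intro equalityI subsetI)
  have p1: "1 < real CARD('p)" by (rule prime_card_gt_1)
  then have t0: "t \<noteq> 0" "padic_norm t > 0" using t by auto
  {
    fix x :: "'p padic" assume "x \<in> padic_ball (k + 1)"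
    then have "padic_norm (x * inverse t) \<le> 1"
      unfolding padic_norm_mult padic_norm_inverse
      using t t0 by (simp add: padic_ball_def field_simps)
    then obtain i where i: "i < CARD('p)" "padic_norm (x * inverse t - of_nat i) < 1"
      by (rule padic_residue_ex)
    have "x - of_nat i * t = (x * inverse t - of_nat i) * t" using t0 by (simp add: algebra_simps)
    then have "padic_norm (x - of_nat i * t) < padic_norm t"
      using i t0 by (simp add: padic_norm_mult)
    then have "x - of_nat i * t \<in> padic_ball k" by (simp add: padic_ball_conv_less t)
    then have "x \<in> (+) (of_nat i * t) ` padic_ball k" by (rule rev_image_eqI) simp
    then show "x \<in> (\<Union>i<CARD('p). (+) (of_nat i * t) ` padic_ball k)" using i by blast
  }
  {
    fix x :: "'p padic" assume "x \<in> (\<Union>i<CARD('p). (+) (of_nat i * t) ` padic_ball k)"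
    then obtain i y where y: "x = of_nat i * t + y" "y \<in> padic_ball k" by auto
    have "padic_norm (of_nat i * t) \<le> padic_norm t"
      using padic_norm_of_int_le_1[of "int i", where 'p='p] t0
      by (simp add: padic_norm_mult)
    moreover have "padic_norm y \<le> padic_norm t"
      using y(2) unfolding padic_ball_conv_less t by simp
    ultimately show "x \<in> padic_ball (k + 1)"
      using padic_norm_add[of "of_nat i * t" y] t unfolding y(1) padic_ball_def by simp
  }
qed

text \<open>A common point of two translates would give \<open>|(i - j) t| < |t|\<close>, so
  \<open>p\<close> would divide \<open>i - j\<close>, impossible for distinct
  \<open>i, j < p\<close>.\<close>

lemma padic_ball_translates_disjoint:
  fixes t :: "'p::prime_card padic"
  assumes t: "padic_norm t = real CARD('p) powr (of_int (k + 1))"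
  shows "disjoint_family_on (\<lambda>i. (+) (of_nat i * t) ` padic_ball k) {..<CARD('p)}"
proof (unfold disjoint_family_on_def, intro ballI impI, rule ccontr)
  fix i j assume ij: "i \<in> {..<CARD('p)}" "j \<in> {..<CARD('p)}" "i \<noteq> j"
    and "(+) (of_nat i * t) ` padic_ball k \<inter> (+) (of_nat j * t) ` padic_ball k \<noteq> {}"
  then obtain x y where xy: "of_nat i * t + x = of_nat j * t + y" "x \<in> padic_ball k" "y \<in> padic_ball k"
    by auto
  then have "of_int (int i - int j) * t = y - x" by (simp add: algebra_simps)
  moreover have "padic_norm (y - x) < padic_norm t"
    using padic_norm_diff_le[of y x] xy(2,3) unfolding padic_ball_conv_less t by simp
  ultimately have "padic_norm (of_int (int i - int j) :: 'p padic) * padic_norm t < padic_norm t"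
    by (metis padic_norm_mult)
  then have "padic_norm (of_int (int i - int j) :: 'p padic) < 1"
    using padic_norm_nonneg[of t] by (simp add: mult_less_cancel_right2)
  then have "int CARD('p) dvd int i - int j" by (simp only: padic_norm_of_int_less_1_iff)
  then show False using ij zdvd_imp_le[of "int CARD('p)" "\<bar>int i - int j\<bar>"] by auto
qed

section \<open>Volumes of balls and spheres from translation invariance\<close>

context
  fixes M :: "'p::prime_card padic measure"
  assumes haar: "is_padic_haar M"
begin

lemma haar_sets [measurable_cong]: "sets M = sets borel"
  using haar by (simp add: is_padic_haar_def)

lemma emeasure_padic_ball_Suc:
  "emeasure M (padic_ball (k + 1)) = ennreal (real CARD('p)) * emeasure M (padic_ball k)"
proof -
  obtain t :: "'p padic" where t: "padic_norm t = real CARD('p) powr (k + 1)"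
    by (metis padic_norm_powr_ex)
  have tr: "emeasure M ((+) a ` padic_ball k) = emeasure M (padic_ball k)" for a
    using haar padic_ball_borel by (auto simp: is_padic_haar_def)
  \<comment> \<open>The translates are closed metric balls, hence measurable, as additivity
    requires.\<close>
  have "(+) a ` padic_ball k = {x. padic_norm (x - a) \<le> real CARD('p) powr k}" for a :: "'p padic"
    by (auto simp: padic_ball_def intro: rev_image_eqI[of "x - a" for x])
  moreover have "{x. padic_norm (x - a) \<le> real CARD('p) powr k} = cball a (real CARD('p) powr k)" for a :: "'p padic"
    by (auto simp: dist_padic_def padic_norm_minus_commute)
  ultimately have ms: "(+) a ` padic_ball k \<in> sets M" for a :: "'p padic"
    by (simp add: haar_sets)
  have "emeasure M (padic_ball (k + 1)) = (\<Sum>i<CARD('p). emeasure M ((+) (of_nat i * t) ` padic_ball k))"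
    unfolding padic_ball_Suc_eq[OF t]
    by (rule sum_emeasure[symmetric]) (auto simp: ms padic_ball_translates_disjoint[OF t])
  also have "\<dots> = ennreal (real CARD('p)) * emeasure M (padic_ball k)"
    by (simp add: tr ennreal_of_nat_eq_real_of_nat)
  finally show ?thesis .
qed

text \<open>The normalization settles \<open>k = 0\<close>. The scaling by \<open>p\<close>
  propagates upwards directly and downwards by cancelling the finite nonzero factor
  \<open>p\<close>.\<close>

lemma emeasure_padic_ball: "emeasure M (padic_ball k) = ennreal (real CARD('p) powr k)"
proof (induct k rule: int_induct[where k=0])
  case base
  show ?case using haar prime_card_gt_1[where 'p='p] by (simp add: is_padic_haar_def padic_ball_def)
next
  case (step1 i)
  then show ?case
    using prime_card_gt_1[where 'p='p]
    by (simp add: emeasure_padic_ball_Suc powr_add ennreal_mult mult.commute)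
next
  case (step2 i)
  have p1: "1 < real CARD('p)" by (rule prime_card_gt_1)
  have "ennreal (real CARD('p)) * emeasure M (padic_ball (i - 1)) = ennreal (real CARD('p) powr i)"
    using emeasure_padic_ball_Suc[of "i - 1"] step2 by simp
  also have "\<dots> = ennreal (real CARD('p)) * ennreal (real CARD('p) powr (i - 1))"
    using p1 by (simp add: powr_diff flip: ennreal_mult)
  finally show ?case using p1 by (simp add: ennreal_mult_cancel_left)
qed

lemma emeasure_padic_sphere:
  "emeasure M (padic_sphere k) = ennreal (real CARD('p) powr k * (1 - 1 / real CARD('p)))"
proof -
  have p1: "1 < real CARD('p)" by (rule prime_card_gt_1)
  have "padic_ball (k - 1) \<subseteq> (padic_ball k :: 'p padic set)"
    using p1 by (auto simp: padic_ball_def elim!: order_trans)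
  then have "emeasure M (padic_sphere k) = ennreal (real CARD('p) powr k) - ennreal (real CARD('p) powr (k - 1))"
    unfolding padic_sphere_eq_diff
    by (subst emeasure_Diff) (auto simp: emeasure_padic_ball haar_sets)
  also have "\<dots> = ennreal (real CARD('p) powr k * (1 - 1 / real CARD('p)))"
    using p1 by (simp add: powr_diff algebra_simps flip: ennreal_minus)
  finally show ?thesis .
qed

lemma borel_measurable_units_measure: "f \<in> borel_measurable borel \<Longrightarrow> f \<in> borel_measurable (units_measure M)"
  unfolding units_measure_def by (rule measurable_restrict_space1) (simp cong: measurable_cong_sets add: haar_sets)

lemma padic_sphere_subset: "padic_sphere k \<subseteq> (- {0} :: 'p padic set)"
  using prime_card_gt_1[where 'p='p] by (auto simp: padic_sphere_def)

lemma padic_sphere_units_sets: "padic_sphere k \<in> sets (units_measure M)"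
  unfolding units_measure_def sets_restrict_space
  using padic_sphere_subset by (intro image_eqI[of _ _ "padic_sphere k"]) (auto simp: haar_sets)

lemma emeasure_units_padic_sphere:
  "emeasure (units_measure M) (padic_sphere k) = ennreal (real CARD('p) powr k * (1 - 1 / real CARD('p)))"
  unfolding units_measure_def
  using padic_sphere_subset
  by (subst emeasure_restrict_space)
    (auto simp: emeasure_padic_sphere haar_sets sets_eq_imp_space_eq[OF haar_sets])

end

section \<open>Step functions on spheres\<close>

text \<open>Besides the test functions, the integrands of the operator and of the norms are compared
  with functions of this shape, which reduces the integrals to finite sums.\<close>

definition padic_step :: "int set \<Rightarrow> (int \<Rightarrow> real) \<Rightarrow> 'p::prime_card padic \<Rightarrow> real" where
  "padic_step F c x = (\<Sum>k\<in>F. c k * indicator (padic_sphere k) x)"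

lemma padic_sphere_unique:
  assumes "(x :: 'p::prime_card padic) \<in> padic_sphere j"
  shows "x \<in> padic_sphere k \<longleftrightarrow> k = j"
  using assms prime_card_gt_1[where 'p='p] powr_inj[of "real CARD('p)" j k]
  by (auto simp: padic_sphere_def)

lemma padic_step_sphere:
  assumes "finite F" "(x :: 'p::prime_card padic) \<in> padic_sphere j"
  shows "padic_step F c x = (if j \<in> F then c j else 0)"
  using assms by (simp add: padic_step_def padic_sphere_unique[OF assms(2)] indicator_def)

lemma padic_sphere_cases:
  fixes x :: "'p::prime_card padic"
  obtains "x = 0" | j where "x \<in> padic_sphere j"
  by (metis (mono_tags) padic_norm_eq_powr padic_sphere_def mem_Collect_eq)

lemma padic_step_zero [simp]: "padic_step F c (0 :: 'p::prime_card padic) = 0"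
  using prime_card_gt_1[where 'p='p] by (simp add: padic_step_def padic_sphere_def indicator_def)

lemma padic_step_borel [measurable]: "padic_step F c \<in> borel_measurable borel"
  unfolding padic_step_def by measurable

context
  fixes M :: "'p::prime_card padic measure"
  assumes haar: "is_padic_haar M"
begin

lemma has_bochner_integral_padic_step:
  "has_bochner_integral (units_measure M) (padic_step F c)
     (\<Sum>k\<in>F. c k * (real CARD('p) powr k * (1 - 1 / real CARD('p))))"
proof -
  have "has_bochner_integral (units_measure M) (indicator (padic_sphere k) :: 'p padic \<Rightarrow> real)
      (real CARD('p) powr k * (1 - 1 / real CARD('p)))" for k
  proof -
    have "measure (units_measure M) (padic_sphere k) = real CARD('p) powr k * (1 - 1 / real CARD('p))"
      using prime_card_gt_1[where 'p='p]
      by (simp add: measure_def emeasure_units_padic_sphere[OF haar])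
    then show ?thesis
      using has_bochner_integral_real_indicator[OF padic_sphere_units_sets[OF haar, of k]]
      by (simp add: emeasure_units_padic_sphere[OF haar])
  qed
  then show ?thesis
    unfolding padic_step_def
    by (intro has_bochner_integral_sum has_bochner_integral_mult_right)
qed

lemmas integrable_padic_step = has_bochner_integral_padic_step[THEN integrable.intros]
lemmas integral_padic_step = has_bochner_integral_padic_step[THEN has_bochner_integral_integral_eq]

section \<open>Lower bounds for the image of a step function\<close>

text \<open>The kernel depends on \<open>x\<close> and \<open>y\<close> only through their norms, so
  for \<open>y\<close> in a sphere the integrand is again a step function. Its integral is a sum of
  nonnegative terms, of which only the term of the sphere containing \<open>y\<close> is
  kept.\<close>

lemma H_op_padic_step_ge:
  fixes F :: "int set" and y :: "'p padic" and a :: real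
  assumes F: "finite F" "j \<in> F" and y: "y \<in> padic_sphere j"
  shows "real CARD('p) powr (j * (\<mu> + \<nu> - lam - a + 1)) * (1 - 1 / real CARD('p))
     \<le> H_op M lam \<mu> \<nu> (padic_step F (\<lambda>k. real CARD('p) powr (- a * k))) y"
proof -
  let ?P = "real CARD('p)"
  have P: "1 < ?P" by (rule prime_card_gt_1)
  define d where "d k = (?P powr k) powr \<mu> * (?P powr j) powr \<nu> / (max (?P powr k) (?P powr j)) powr lam
      * ?P powr (- a * k)" for k :: int
  have "H_integrand lam \<mu> \<nu> (padic_step F (\<lambda>k. ?P powr (- a * k))) y x = padic_step F d x" for x
  proof (cases x rule: padic_sphere_cases)
    case 1
    then show ?thesis by (simp add: H_integrand_def)
  next
    case (2 k)
    moreover have "padic_norm x = ?P powr k" "padic_norm y = ?P powr j"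
      using 2 y by (simp_all add: padic_sphere_def)
    ultimately show ?thesis using F by (simp add: H_integrand_def padic_step_sphere d_def)
  qed
  then have "H_op M lam \<mu> \<nu> (padic_step F (\<lambda>k. ?P powr (- a * k))) y
      = (\<Sum>k\<in>F. d k * (?P powr k * (1 - 1 / ?P)))"
    by (simp add: H_op_def integral_padic_step)
  also have "\<dots> \<ge> d j * (?P powr j * (1 - 1 / ?P))"
    using F P by (intro member_le_sum) (auto simp: d_def)
  \<comment> \<open>For \<open>k = j\<close> the maximum in the kernel is \<open>P powr j\<close>,
    so the exponents add up; the summand 1 comes from the volume of the sphere.\<close>
  also have "d j * (?P powr j * (1 - 1 / ?P)) = ?P powr (j * (\<mu> + \<nu> - lam - a + 1)) * (1 - 1 / ?P)"
    using P by (simp add: d_def powr_powr algebra_simps flip: powr_add powr_diff)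
  finally show ?thesis .
qed

text \<open>The pointwise bound is raised to the power \<open>r\<close>, weighted and integrated
  over each sphere. In the power of \<open>1 - 1/p\<close>, the part \<open>r\<close> comes from the
  pointwise bound and the part 1 from the volume of the sphere.\<close>

lemma integral_H_op_padic_step_ge:
  fixes F :: "int set" and a r lam \<mu> \<nu> \<beta> :: real
  defines "f \<equiv> padic_step F (\<lambda>k. real CARD('p) powr (- a * k))"
  assumes F: "finite F" and r: "1 \<le> r" and Y: "H_op M lam \<mu> \<nu> f \<in> Lq M r \<beta>"
  shows "(\<Sum>j\<in>F. real CARD('p) powr (j * (r * (\<mu> + \<nu> - lam - a + 1) + \<beta> + 1)))
       * (1 - 1 / real CARD('p)) powr (r + 1)
     \<le> (LINT y|units_measure M. \<bar>H_op M lam \<mu> \<nu> f y\<bar> powr r * padic_norm y powr \<beta>)"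
proof -
  let ?P = "real CARD('p)"
  define s where "s = \<mu> + \<nu> - lam - a + 1"
  have P: "1 < ?P" by (rule prime_card_gt_1)
  define d where "d j = (?P powr (j * s) * (1 - 1 / ?P)) powr r * (?P powr j) powr \<beta>" for j :: int
  have le: "padic_step F d y \<le> \<bar>H_op M lam \<mu> \<nu> f y\<bar> powr r * padic_norm y powr \<beta>" for y :: "'p padic"
  proof (cases y rule: padic_sphere_cases)
    case 1
    then show ?thesis by simp
  next
    case (2 j)
    then have n: "padic_norm y = ?P powr j" by (simp add: padic_sphere_def)
    show ?thesis
    proof (cases "j \<in> F")
      case True
      have "?P powr (j * s) * (1 - 1 / ?P) \<le> \<bar>H_op M lam \<mu> \<nu> f y\<bar>"
        using H_op_padic_step_ge[OF F True 2, of \<mu> \<nu> lam a] by (simp add: f_def s_def)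
      then have "(?P powr (j * s) * (1 - 1 / ?P)) powr r \<le> \<bar>H_op M lam \<mu> \<nu> f y\<bar> powr r"
        using P r by (intro powr_mono2) auto
      then show ?thesis
        using True by (simp add: padic_step_sphere[OF F 2] n d_def mult_right_mono)
    qed (simp add: padic_step_sphere[OF F 2])
  qed
  have "d j * (?P powr j * (1 - 1 / ?P)) = ?P powr (j * (r * s + \<beta> + 1)) * (1 - 1 / ?P) powr (r + 1)" for j
  proof -
    have "d j * (?P powr j * (1 - 1 / ?P))
        = (?P powr (j * s * r) * ?P powr (j * \<beta>) * ?P powr j) * ((1 - 1 / ?P) powr r * (1 - 1 / ?P) powr 1)"
      using P by (simp add: d_def powr_mult powr_powr)
    also have "\<dots> = ?P powr (j * (r * s + \<beta> + 1)) * (1 - 1 / ?P) powr (r + 1)"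
      by (simp only: powr_add[symmetric]) (simp add: algebra_simps)
    finally show ?thesis .
  qed
  then have "(\<Sum>j\<in>F. ?P powr (j * (r * s + \<beta> + 1))) * (1 - 1 / ?P) powr (r + 1)
      = (LINT y|units_measure M. padic_step F d y)"
    by (simp add: integral_padic_step sum_distrib_right)
  \<comment> \<open>Membership in \<open>Lq\<close> supplies integrability of the right-hand side; a
    non-integrable function would have integral 0 by default.\<close>
  also have "\<dots> \<le> (LINT y|units_measure M. \<bar>H_op M lam \<mu> \<nu> f y\<bar> powr r * padic_norm y powr \<beta>)"
    using Y by (intro integral_mono integrable_padic_step le) (simp add: Lq_def)
  finally show ?thesis by (simp add: s_def)
qed

text \<open>The exponent \<open>e\<close> plays the role of \<open>1/q\<close>, with
  \<open>e = 0\<close> for \<open>q = \<infinity>\<close>, so one argument serves both cases: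
  boundedness would keep \<open>N powr (1/r - e)\<close> below a constant independent of
  \<open>N\<close>.\<close>

lemma not_H_bounded_if_steps_small:
  fixes a e r :: real
  assumes r: "1 \<le> r" and e: "e < 1 / r"
    and X: "\<And>F. finite F \<Longrightarrow> F \<noteq> {} \<Longrightarrow> padic_step F (\<lambda>k. real CARD('p) powr (- a * k)) \<in> X"
    and nX: "\<And>F. finite F \<Longrightarrow> F \<noteq> {} \<Longrightarrow>
      \<bar>nX (padic_step F (\<lambda>k. real CARD('p) powr (- a * k)))\<bar> \<le> real (card F) powr e"
  shows "\<not> H_bounded M lam \<mu> \<nu> X nX (Lq M r \<beta>) (Lq_norm M r \<beta>)"
proof
  let ?P = "real CARD('p)"
  let ?f = "\<lambda>F. padic_step F (\<lambda>k. real CARD('p) powr (- a * k)) :: 'p padic \<Rightarrow> real"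
  define D where "D = r * (\<mu> + \<nu> - lam - a + 1) + \<beta> + 1"
  define b where "b = (1 - 1 / ?P) powr (r + 1)"
  have P: "1 < ?P" by (rule prime_card_gt_1)
  then have b: "b > 0" by (simp add: b_def)
  assume "H_bounded M lam \<mu> \<nu> X nX (Lq M r \<beta>) (Lq_norm M r \<beta>)"
  then obtain C where C: "\<And>f. f \<in> X \<Longrightarrow> H_op M lam \<mu> \<nu> f \<in> Lq M r \<beta>"
      "\<And>f. f \<in> X \<Longrightarrow> Lq_norm M r \<beta> (H_op M lam \<mu> \<nu> f) \<le> C * nX f"
    unfolding H_bounded_def by blast
  have bound: "real N powr (1 / r - e) \<le> \<bar>C\<bar> / b powr (1 / r)" if N: "N > 0" for N :: nat
  proof -
    \<comment> \<open>The half-line of spheres on which the weights \<open>P powr (j * D)\<close> do not decay.\<close>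
    define F :: "int set" where "F = (if D \<ge> 0 then {0..<int N} else {- int N<..0})"
    have F: "finite F" "F \<noteq> {}" "card F = N" using N by (auto simp: F_def)
    have "0 \<le> j * D" if "j \<in> F" for j :: int
      using that by (auto simp: F_def mult_nonpos_nonpos split: if_splits)
    then have "(\<Sum>j\<in>F. 1) \<le> (\<Sum>j\<in>F. ?P powr (j * D))"
      using P by (intro sum_mono ge_one_powr_ge_zero) auto
    then have "real N * b \<le> (\<Sum>j\<in>F. ?P powr (j * D)) * b"
      using F b by (intro mult_right_mono) auto
    also have "\<dots> \<le> (LINT y|units_measure M. \<bar>H_op M lam \<mu> \<nu> (?f F) y\<bar> powr r * padic_norm y powr \<beta>)"
      using integral_H_op_padic_step_ge[OF F(1) r C(1)[OF X[OF F(1,2)]]] by (simp only: D_def b_def)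
    finally have "(real N * b) powr (1 / r) \<le> Lq_norm M r \<beta> (H_op M lam \<mu> \<nu> (?f F))"
      unfolding Lq_norm_def using b r by (intro powr_mono2) auto
    \<comment> \<open>The signs of \<open>C\<close> and of \<open>nX\<close> are unspecified, hence
      the absolute values.\<close>
    also have "\<dots> \<le> \<bar>C\<bar> * \<bar>nX (?f F)\<bar>"
      using C(2)[OF X[OF F(1,2)]] by (simp flip: abs_mult)
    also have "\<dots> \<le> \<bar>C\<bar> * real N powr e"
      using nX[OF F(1,2)] F(3) by (intro mult_left_mono) auto
    finally show ?thesis
      using N b by (simp add: powr_mult powr_diff field_simps)
  qed
  define d where "d = 1 / r - e"
  define T where "T = \<bar>C\<bar> / b powr (1 / r)"
  have "d > 0" "T \<ge> 0" using e b by (simp_all add: d_def T_def)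
  \<comment> \<open>The threshold \<open>T powr (1 / d)\<close> solves \<open>x powr d = T\<close>,
    so any larger \<open>N\<close> violates the bound.\<close>
  obtain N :: nat where N: "T powr (1 / d) < real N" using reals_Archimedean2 by blast
  then have "(T powr (1 / d)) powr d < real N powr d"
    using \<open>d > 0\<close> by (intro powr_less_mono2) auto
  then have "T < real N powr d" using \<open>d > 0\<close> \<open>T \<ge> 0\<close> by (simp add: powr_powr)
  moreover have "N > 0" using N powr_ge_zero[of T "1 / d"] by (metis of_nat_0_less_iff order_le_less_trans)
  ultimately show False using bound[of N] by (simp add: d_def T_def)
qed

section \<open>Norms of the test functions\<close>

text \<open>On the sphere of radius \<open>p^k\<close> the weighted power of \<open>f\<close> is
  \<open>p^(-(\<alpha> + 1) k) * p^(\<alpha> k) = p^(-k)\<close>, which cancels the growth of the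
  volume: each sphere contributes \<open>1 - 1/p\<close>, at most 1.\<close>

lemma padic_step_Lq:
  fixes F :: "int set" and \<alpha> q :: real
  defines "f \<equiv> padic_step F (\<lambda>k. real CARD('p) powr (- ((\<alpha> + 1) / q) * k))"
  assumes F: "finite F" and q: "q > 0"
  shows "f \<in> Lq M q \<alpha>" and "\<bar>Lq_norm M q \<alpha> f\<bar> \<le> real (card F) powr (1 / q)"
proof -
  let ?P = "real CARD('p)"
  have P: "1 < ?P" by (rule prime_card_gt_1)
  have eq: "\<bar>f x\<bar> powr q * padic_norm x powr \<alpha> = padic_step F (\<lambda>k. ?P powr (- real_of_int k)) x" for x
  proof (cases x rule: padic_sphere_cases)
    case 1
    then show ?thesis by simp
  next
    case (2 k)
    then have "padic_norm x = ?P powr k" by (simp add: padic_sphere_def)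
    moreover have "- ((\<alpha> + 1) / q) * k * q + k * \<alpha> = - real_of_int k"
      using q by (simp add: field_simps)
    ultimately show ?thesis
      using q by (simp add: f_def padic_step_sphere[OF F 2] powr_powr flip: powr_add)
  qed
  show "f \<in> Lq M q \<alpha>"
    using borel_measurable_units_measure[OF haar padic_step_borel]
    by (simp add: Lq_def eq integrable_padic_step) (simp add: f_def)
  have "?P powr (- real_of_int k) * (?P powr k * (1 - 1 / ?P)) = 1 - 1 / ?P" for k :: int
    using P by (simp add: powr_minus field_simps)
  then have "(\<Sum>k\<in>F. ?P powr (- real_of_int k) * (?P powr k * (1 - 1 / ?P))) = real (card F) * (1 - 1 / ?P)"
    by (simp only: sum_constant)
  then have "Lq_norm M q \<alpha> f = (real (card F) * (1 - 1 / ?P)) powr (1 / q)"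
    unfolding Lq_norm_def eq integral_padic_step by simp
  also have "\<dots> \<le> real (card F) powr (1 / q)"
    using P q by (intro powr_mono2) (auto simp: mult_left_le)
  finally show "\<bar>Lq_norm M q \<alpha> f\<bar> \<le> real (card F) powr (1 / q)"
    by (simp add: Lq_norm_def)
qed

lemma padic_step_Linf:
  fixes F :: "int set"
  assumes F: "finite F"
  shows "padic_step F (\<lambda>k. 1) \<in> Linf M" and "\<bar>Linf_norm M (padic_step F (\<lambda>k. 1))\<bar> \<le> 1"
proof -
  let ?U = "units_measure M" and ?f = "padic_step F (\<lambda>k. 1) :: 'p padic \<Rightarrow> real"
  have meas: "?f \<in> borel_measurable ?U"
    by (simp add: borel_measurable_units_measure[OF haar] padic_step_borel)
  have "\<bar>?f x\<bar> \<le> 1" for x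
    by (cases x rule: padic_sphere_cases) (auto simp: padic_step_sphere[OF F])
  then have le: "esssup ?U (\<lambda>x. ereal \<bar>?f x\<bar>) \<le> 1"
    using meas by (intro esssup_I) (auto simp: one_ereal_def)
  \<comment> \<open>The space has positive measure, so the constant 0 has essential supremum 0; by
    monotonicity this bounds the norm from below.\<close>
  have "emeasure ?U (padic_sphere 0) \<noteq> 0"
    using prime_card_gt_1[where 'p='p] by (simp add: emeasure_units_padic_sphere[OF haar])
  then have "emeasure ?U (space ?U) \<noteq> 0"
    using emeasure_space[of ?U "padic_sphere 0"] by auto
  then have "0 = esssup ?U (\<lambda>x. 0 :: ereal)" by (simp add: esssup_const)
  also have "\<dots> \<le> esssup ?U (\<lambda>x. ereal \<bar>?f x\<bar>)" by (intro esssup_mono) auto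
  finally have ge: "0 \<le> esssup ?U (\<lambda>x. ereal \<bar>?f x\<bar>)" .
  show "?f \<in> Linf M" using meas le by (auto simp: Linf_def)
  show "\<bar>Linf_norm M ?f\<bar> \<le> 1"
    using le ge unfolding Linf_norm_def
    by (cases "esssup ?U (\<lambda>x. ereal \<bar>?f x\<bar>)") auto
qed

end

theorem mainTheorem6:
  fixes M :: "'p::prime_card padic measure"
    and q :: ereal
    and r lam \<mu> \<nu> \<alpha> \<beta> :: real
  assumes "is_padic_haar M"
    and "1 \<le> r" and "ereal r < q"
  shows "(q < \<infinity> \<longrightarrow> \<not> H_bounded M lam \<mu> \<nu>
            (Lq M (real_of_ereal q) \<alpha>) (Lq_norm M (real_of_ereal q) \<alpha>) (Lq M r \<beta>) (Lq_norm M r \<beta>))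
       \<and> (q = \<infinity> \<longrightarrow> \<not> H_bounded M lam \<mu> \<nu> (Linf M) (Linf_norm M) (Lq M r \<beta>) (Lq_norm M r \<beta>))"
proof (intro conjI impI)
  assume "q < \<infinity>"
  then obtain s where s: "q = ereal s" "r < s" using assms(3) by (cases q) auto
  \<comment> \<open>With \<open>e = 1/s\<close>, the hypothesis \<open>r < s\<close> gives
    \<open>e < 1/r\<close>.\<close>
  show "\<not> H_bounded M lam \<mu> \<nu>
      (Lq M (real_of_ereal q) \<alpha>) (Lq_norm M (real_of_ereal q) \<alpha>) (Lq M r \<beta>) (Lq_norm M r \<beta>)"
    using assms(2) s padic_step_Lq[OF assms(1)]
    by (intro not_H_bounded_if_steps_small[OF assms(1,2), where a="(\<alpha> + 1) / s" and e="1 / s"])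
      (auto intro!: divide_strict_left_mono)
next
  \<comment> \<open>With \<open>a = 0\<close> all coefficients become 1. The norm bound reads
    \<open>card F powr 0\<close>, which equals 1 only for nonempty \<open>F\<close>, because
    \<open>0 powr 0 = 0\<close>.\<close>
  show "\<not> H_bounded M lam \<mu> \<nu> (Linf M) (Linf_norm M) (Lq M r \<beta>) (Lq_norm M r \<beta>)"
    using assms(2) padic_step_Linf[OF assms(1)] prime_card_gt_1[where 'p='p]
    by (intro not_H_bounded_if_steps_small[OF assms(1,2), where a=0 and e=0]) (auto simp: card_gt_0_iff)
qed

end
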